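(* Let $n\ge 1$ and let $K_1,\dots,K_n:(-\infty,0)\cup(0,\infty)\to\mathbb{R}$ be singular, strictly concave kernel functions, each satisfying the generalized monotonicity condition $\lim_{t\to-\infty}K_j'(t)\le\lim_{t\to\infty}K_j'(t)$. Let $J:\mathbb{R}\to\mathbb{R}\cup\{-\infty\}$ be an $n$-field function that is admissible for $K_1,\dots,K_n$. Then the difference function $$D:R\to\mathbb{R}^n,\qquad D(\mathbf{y})=(m_1(\mathbf{y})-m_0(\mathbf{y}),\,m_2(\mathbf{y})-m_1(\mathbf{y}),\dots,m_n(\mathbf{y})-m_{n-1}(\mathbf{y}))$$ is a homeomorphism between the regularity set $R$ and $\mathbb{R}^n$. Moreover, $D$ is locally bi-Lipschitz.
   Context: Kernel function: a function $K:(-\infty,0)\cup(0,\infty)\to\mathbb{R}$ that is concave on $(-\infty,0)$ and concave on $(0,\infty)$ and such that $\lim_{t\downarrow0}K(t)=\lim_{t\uparrow0}K(t)$, the common value being real or $-\infty$; one extends $K$ by $K(0):=\lim_{t\to0}K(t)$. $K$ is singular if $K(0)=-\infty$. $K$ is strictly concave if it is strictly concave on $(-\infty,0)$ and strictly concave on $(0,\infty)$ (separately). $K'$ is considered on the full-measure set where it exists, and limits of $K'$ are taken along this set (they exist in the extended sense by concavity). $n$-field function on $\mathbb{R}$: a function $J:\mathbb{R}\to\mathbb{R}\cup\{-\infty\}$ that is bounded above and takes finite values at more than $n$ different points. It is admissible for $K_1,\dots,K_n$ if $\lim_{|t|\to\infty}\big(J(t)+\sum_{j=1}^nK_j(t)\big)=-\infty$.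 Let $\overline{S^\infty}:=\{(y_1,\dots,y_n)\in\mathbb{R}^n: y_1\le\dots\le y_n\}$. For $\mathbf{y}\in\overline{S^\infty}$ and $t\in\mathbb{R}$ put $F(\mathbf{y},t):=J(t)+\sum_{j=1}^nK_j(t-y_j)\in\mathbb{R}\cup\{-\infty\}$ and $m_0(\mathbf{y}):=\sup_{t\in(-\infty,y_1]}F(\mathbf{y},t)$, $m_n(\mathbf{y}):=\sup_{t\in[y_n,\infty)}F(\mathbf{y},t)$, $m_j(\mathbf{y}):=\sup_{t\in[y_j,y_{j+1}]}F(\mathbf{y},t)$ for $j=1,\dots,n-1$. Regularity set: $R:=\{\mathbf{y}\in\overline{S^\infty}: m_j(\mathbf{y})\ne-\infty\text{ for }j=0,\dots,n\}$, with the topology inherited from $\mathbb{R}^n$. Locally bi-Lipschitz: every point of $R$ has a neighbourhood $U$ in $R$ and constants $0<c\le C$ with $c\|\mathbf{x}-\mathbf{y}\|\le\|D(\mathbf{x})-D(\mathbf{y})\|\le C\|\mathbf{x}-\mathbf{y}\|$ for all $\mathbf{x},\mathbf{y}\in U$. *)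

theory Defs
  imports "HOL-Analysis.Analysis"
begin

text \<open>
  \<open>\<real>\<^sup>n\<close> is rendered as \<^typ>\<open>real ^ 'n\<close> with \<open>'n\<close> an arbitrary nonempty finite linearly
  ordered type and \<open>n = CARD('n)\<close>. The \<open>j\<close>-th coordinate \<open>y\<^sub>j\<close>
  (\<open>1 \<le> j \<le> n\<close>) is the one belonging to the \<open>j\<close>-th smallest index, that is to the index
  with exactly \<open>j\<close> indices below or equal to it.
\<close>

definition nth_index :: "nat \<Rightarrow> 'n::{finite,linorder}" where
  "nth_index j = (THE i. card {..i} = j)"

lemma bij_betw_card_atMost:
  "bij_betw (\<lambda>i::'n::{finite,linorder}. card {..i}) UNIV {1..CARD('n)}"
proof -
  have less: "card {..i} < card {..k}" if "i < k" for i k :: 'n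
    using that by (intro psubset_card_mono) auto
  then have inj: "inj (\<lambda>i::'n. card {..i})"
    unfolding inj_def by (metis less_irrefl neq_iff)
  have "range (\<lambda>i::'n. card {..i}) \<subseteq> {1..CARD('n)}"
  proof
    fix j assume "j \<in> range (\<lambda>i::'n. card {..i})"
    then obtain i :: 'n where j: "j = card {..i}" by blast
    have "card {i} \<le> card {..i}" "card {..i} \<le> CARD('n)"
      by (rule card_mono; simp)+
    with j show "j \<in> {1..CARD('n)}" by simp
  qed
  moreover have "card (range (\<lambda>i::'n. card {..i})) = card {1..CARD('n)}"
    using inj by (simp add: card_image)
  ultimately have "range (\<lambda>i::'n. card {..i}) = {1..CARD('n)}"
    by (intro card_subset_eq) auto
  with inj show ?thesis
    by (simp add: bij_betw_def)
qed

lemma nth_index_card_atMost: "nth_index (card {..i}) = (i::'n::{finite,linorder})"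
  unfolding nth_index_def
proof (rule the_equality)
  show "k = i" if "card {..k} = card {..i}" for k
    using bij_betw_imp_inj_on[OF bij_betw_card_atMost[where 'n='n]] that by (rule injD)
qed simp

lemma card_atMost_nth_index:
  assumes "1 \<le> j" "j \<le> CARD('n)"
  shows "card {..nth_index j :: 'n::{finite,linorder}} = j"
proof -
  have "j \<in> range (\<lambda>i::'n. card {..i})"
    using assms bij_betw_imp_surj_on[OF bij_betw_card_atMost[where 'n='n]] by simp
  then show ?thesis
    by (auto simp: nth_index_card_atMost)
qed

text \<open>
  A kernel is a total function on \<^typ>\<open>real\<close> whose value at \<open>0\<close> is never used;
  \<open>kernel_ext\<close> puts the limit there instead.
\<close>

definition kernel_function :: "(real \<Rightarrow> real) \<Rightarrow> bool" where
  "kernel_function K \<longleftrightarrow>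
     concave_on {..<0} K \<and> concave_on {0<..} K \<and>
     (\<exists>c::ereal. c \<noteq> \<infinity> \<and>
        ((\<lambda>t. ereal (K t)) \<longlongrightarrow> c) (at_right 0) \<and>
        ((\<lambda>t. ereal (K t)) \<longlongrightarrow> c) (at_left 0))"

definition kernel_ext :: "(real \<Rightarrow> real) \<Rightarrow> real \<Rightarrow> ereal" where
  "kernel_ext K t = (if t = 0 then Lim (at 0) (\<lambda>s. ereal (K s)) else ereal (K t))"

definition singular_kernel :: "(real \<Rightarrow> real) \<Rightarrow> bool" where
  "singular_kernel K \<longleftrightarrow> kernel_ext K 0 = -\<infinity>"

definition strictly_concave_on :: "'a::real_vector set \<Rightarrow> ('a \<Rightarrow> real) \<Rightarrow> bool" where
  "strictly_concave_on S f \<longleftrightarrow> convex S \<and>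
     (\<forall>x\<in>S. \<forall>y\<in>S. \<forall>u>0. \<forall>v>0. x \<noteq> y \<longrightarrow> u + v = 1 \<longrightarrow>
        f (u *\<^sub>R x + v *\<^sub>R y) > u * f x + v * f y)"

definition strictly_concave_kernel :: "(real \<Rightarrow> real) \<Rightarrow> bool" where
  "strictly_concave_kernel K \<longleftrightarrow> strictly_concave_on {..<0} K \<and> strictly_concave_on {0<..} K"

text \<open>
  The limit of \<open>K'\<close> along \<open>F\<close>, restricted to the points of differentiability. For kernel
  functions and \<open>F\<close> = \<^term>\<open>at_bot\<close> or \<^term>\<open>at_top\<close> it exists in the extended reals,
  because \<open>K'\<close> is monotone on each half-line.
\<close>

definition deriv_limit :: "real filter \<Rightarrow> (real \<Rightarrow> real) \<Rightarrow> ereal" where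
  "deriv_limit F K = Lim (inf F (principal {t. K differentiable (at t)})) (\<lambda>t. ereal (deriv K t))"

definition generalized_monotone :: "(real \<Rightarrow> real) \<Rightarrow> bool" where
  "generalized_monotone K \<longleftrightarrow> deriv_limit at_bot K \<le> deriv_limit at_top K"

definition field_function :: "nat \<Rightarrow> (real \<Rightarrow> ereal) \<Rightarrow> bool" where
  "field_function n J \<longleftrightarrow>
     (\<exists>M::real. \<forall>t. J t \<le> ereal M) \<and>
     (infinite {t. J t \<noteq> -\<infinity>} \<or> card {t. J t \<noteq> -\<infinity>} > n)"

definition admissible :: "(real \<Rightarrow> ereal) \<Rightarrow> ('n::finite \<Rightarrow> real \<Rightarrow> real) \<Rightarrow> bool" where
  "admissible J K \<longleftrightarrow>
     ((\<lambda>t. J t + (\<Sum>j\<in>UNIV. kernel_ext (K j) t)) \<longlongrightarrow> -\<infinity>) at_infinity"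

definition closed_simplex :: "(real ^ 'n::{finite,linorder}) set" where
  "closed_simplex = {y. \<forall>i j. i \<le> j \<longrightarrow> y $ i \<le> y $ j}"

definition sum_translates ::
    "(real \<Rightarrow> ereal) \<Rightarrow> ('n::finite \<Rightarrow> real \<Rightarrow> real) \<Rightarrow> real ^ 'n \<Rightarrow> real \<Rightarrow> ereal" where
  "sum_translates J K y t = J t + (\<Sum>j\<in>UNIV. kernel_ext (K j) (t - y $ j))"

text \<open>The interval \<open>I\<^sub>j(y)\<close>, for \<open>j = 0, \<dots>, n\<close>.\<close>

definition node_interval :: "real ^ 'n::{finite,linorder} \<Rightarrow> nat \<Rightarrow> real set" where
  "node_interval y j =
     (if j = 0 then {..y $ nth_index 1}
      else if j = CARD('n) then {y $ nth_index (CARD('n))..}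
      else {y $ nth_index j..y $ nth_index (j + 1)})"

definition interval_sup ::
    "(real \<Rightarrow> ereal) \<Rightarrow> ('n::{finite,linorder} \<Rightarrow> real \<Rightarrow> real) \<Rightarrow> nat \<Rightarrow>
      real ^ 'n::{finite,linorder} \<Rightarrow> ereal" where
  "interval_sup J K j y = (SUP t\<in>node_interval y j. sum_translates J K y t)"

definition regularity_set ::
    "(real \<Rightarrow> ereal) \<Rightarrow> ('n::{finite,linorder} \<Rightarrow> real \<Rightarrow> real) \<Rightarrow> (real ^ 'n::{finite,linorder}) set" where
  "regularity_set J K =
     {y \<in> closed_simplex. \<forall>j\<le>CARD('n). interval_sup J K j y \<noteq> -\<infinity>}"

text \<open>
  If \<open>i\<close> is the \<open>j\<close>-th smallest index, then \<^term>\<open>card {..i} = j\<close> and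
  \<^term>\<open>card {..<i} = j - 1\<close>, so the coordinate of \<open>D(y)\<close> at \<open>i\<close> is
  \<open>m\<^sub>j(y) - m\<^bsub>j-1\<^esub>(y)\<close>. Under the hypotheses of the theorem both suprema are real
  numbers when \<open>y\<close> is in the regularity set.
\<close>

definition difference_function ::
    "(real \<Rightarrow> ereal) \<Rightarrow> ('n::{finite,linorder} \<Rightarrow> real \<Rightarrow> real) \<Rightarrow>
      real ^ 'n::{finite,linorder} \<Rightarrow> real ^ 'n::{finite,linorder}" where
  "difference_function J K y =
     (\<chi> i. real_of_ereal (interval_sup J K (card {..i}) y - interval_sup J K (card {..<i}) y))"

definition locally_bi_Lipschitz_on ::
    "'a::real_normed_vector set \<Rightarrow> ('a \<Rightarrow> 'b::real_normed_vector) \<Rightarrow> bool" where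
  "locally_bi_Lipschitz_on R D \<longleftrightarrow>
     (\<forall>z\<in>R. \<exists>U c C. openin (top_of_set R) U \<and> z \<in> U \<and> 0 < c \<and> c \<le> C \<and>
        (\<forall>x\<in>U. \<forall>y\<in>U. c * norm (x - y) \<le> norm (D x - D y) \<and>
                      norm (D x - D y) \<le> C * norm (x - y)))"

end

theory Submission
  imports Defs
begin

text \<open>
  Generalized monotonicity allows one to subtract linear functions from the kernels so that they
  decrease on the left half-line and increase on the right one; the field absorbs these functions
  and \<open>D\<close> does not change. Then, for \<open>x \<le> z\<close> in \<open>R\<close> (coordinatewise), the sum
  \<open>m\<^sub>n - m\<^sub>0\<close> of the coordinates of \<open>D\<close> decreases from \<open>x\<close> to \<open>z\<close>, locally at a linear
  rate, while by concavity \<open>D\<^sub>k(x) \<le> D\<^sub>k(z)\<close> whenever \<open>x\<^sub>k = z\<^sub>k\<close>. (In the smooth case \<open>-D'\<close>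
  is a column diagonally dominant M-matrix.) As \<open>R\<close> is closed under coordinatewise maxima, comparing
  \<open>x\<close> and \<open>y\<close> with their maximum gives injectivity and the lower Lipschitz bound.
  Near maximizers stay bounded and away from the nodes, which gives the upper bound and
  makes the image of \<open>D\<close> closed; invariance of domain makes it open, so \<open>D\<close> is onto.
\<close>

section \<open>Concave functions of one real variable\<close>

text \<open>No regularity of the field is assumed: the suprema need not be attained, and
  \<open>D\<close> has no derivative to work with. Every estimate therefore compares values of
  \<open>F\<close> at points almost attaining a supremum, and an exchange inequality between two
  points replaces the sign of a partial derivative. The second obstacle is uniformity in
  \<open>y\<close>: admissibility concerns untranslated kernels, while nodes may escape to infinity.
  It is met by measuring \<open>F y t\<close> against \<open>F y t0\<close> for a test point
  \<open>t0\<close> at a fixed distance from all nodes; the possibly unbounded terms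
  \<open>K l (t0 - y $ l)\<close> occur on both sides and cancel. The hypothesis of more than
  \<open>n\<close> finite values supplies such points, since \<open>n\<close> nodes cannot come
  close to all of \<open>n + 1\<close> separated points. Strict concavity enters through the strict
  monotonicity of the normalized kernels, which yields the positive rate at which
  \<open>m (CARD('n))\<close> falls.\<close>

lemma concave_on_slope_antimono:
  fixes f :: "real \<Rightarrow> real"
  assumes f: "concave_on S f" and mem: "a \<in> S" "b \<in> S" "c \<in> S" "d \<in> S"
    and ord: "a < b" "c < d" "a \<le> c" "b \<le> d"
  shows "(f d - f c) / (d - c) \<le> (f b - f a) / (b - a)"
proof -
  have g: "convex_on S (\<lambda>x. - f x)"
    using f by (simp add: concave_on_def)
  have "(f d - f a) / (d - a) \<le> (f b - f a) / (b - a)"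
  proof (cases "b = d")
    case False
    with ord have "b < d" by simp
    from convex_on_slope_le(1)[OF g mem(1,4) ord(1) this] ord show ?thesis
      by (simp add: divide_simps mult.commute split: if_splits) argo
  qed simp
  moreover have "(f d - f c) / (d - c) \<le> (f d - f a) / (d - a)"
  proof (cases "a = c")
    case False
    with ord have "a < c" by simp
    from convex_on_slope_le(2)[OF g mem(1,4) this ord(2)] ord show ?thesis
      by (simp add: divide_simps mult.commute split: if_splits) argo
  qed simp
  ultimately show ?thesis by simp
qed

lemma concave_on_increment_antimono:
  fixes f :: "real \<Rightarrow> real"
  assumes "concave_on S f" "a \<in> S" "c \<in> S" "a + h \<in> S" "c + h \<in> S" "a \<le> c" "0 \<le> h"
  shows "f (c + h) - f c \<le> f (a + h) - f a"
proof (cases "h = 0")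
  case False
  with concave_on_slope_antimono[OF assms(1,2,4,3,5)] assms show ?thesis
    by (simp add: divide_le_cancel)
qed simp

text \<open>A steep parabola added to \<open>f\<close> forces an interior minimum \<open>x\<close>.
  There \<open>f\<close> lies above a downward parabola touching it, and concavity reflects this
  into a bound from above, so the difference quotients converge. The result makes limits of the
  derivative meaningful: they run along a nontrivial filter.\<close>

lemma concave_on_differentiable_somewhere:
  fixes f :: "real \<Rightarrow> real"
  assumes f: "concave_on {a<..<b} f" and "a < b"
  shows "\<exists>x\<in>{a<..<b}. f differentiable (at x)"
proof -
  define p m q where "p = a + (b - a) / 4" "m = a + (b - a) / 2" "q = a + 3 * (b - a) / 4"
  have ord: "a < p" "p < m" "m < q" "q < b" "m - p = (b - a) / 4" "q - m = (b - a) / 4"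
    using \<open>a < b\<close> by (auto simp: p_m_q_def field_simps)
  have "continuous_on {a<..<b} (\<lambda>x. - f x)"
    using f by (intro convex_on_continuous) (auto simp: concave_on_def)
  then have "continuous_on {a<..<b} f"
    using continuous_on_minus by fastforce
  then have cont: "continuous_on {p..q} f"
    by (rule continuous_on_subset) (use ord in auto)
  \<comment> \<open>This size lifts \<open>g\<close> at both endpoints \<open>p\<close> and
    \<open>q\<close> above \<open>g m\<close>, so the minimum cannot lie at an endpoint.\<close>
  define N where "N = (\<bar>f m\<bar> + \<bar>f p\<bar> + \<bar>f q\<bar> + 1) / ((b - a) / 4)\<^sup>2"
  define g where "g x = f x + N * (x - m)\<^sup>2" for x
  have pos: "((b - a) / 4)\<^sup>2 > 0" using \<open>a < b\<close> by simp
  then have N: "N \<ge> 0" "N * ((b - a) / 4)\<^sup>2 = \<bar>f m\<bar> + \<bar>f p\<bar> + \<bar>f q\<bar> + 1"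
    by (auto simp: N_def)
  have "(p - m)\<^sup>2 = ((b - a) / 4)\<^sup>2" "(q - m)\<^sup>2 = ((b - a) / 4)\<^sup>2"
    using ord by (metis power2_commute)+
  with N have gpq: "g m < g p" "g m < g q"
    by (simp_all add: g_def)
  have "\<exists>x\<in>{p..q}. \<forall>y\<in>{p..q}. g x \<le> g y"
    unfolding g_def using ord
    by (intro continuous_attains_inf) (auto intro!: continuous_intros cont)
  then obtain x where x: "x \<in> {p..q}" and xmin: "\<And>y. y \<in> {p..q} \<Longrightarrow> g x \<le> g y"
    by blast
  from xmin[of m] ord have "g x \<le> g m" by auto
  with gpq have "x \<noteq> p" "x \<noteq> q" by auto
  with x have x: "p < x" "x < q" by auto
  \<comment> \<open>The derivative of \<open>f\<close> at the minimum must cancel that of the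
    parabola.\<close>
  define d where "d = - 2 * N * (x - m)"
  define \<delta> where "\<delta> = min (x - p) (q - x)"
  have \<delta>: "\<delta> > 0" using x by (simp add: \<delta>_def)
  have below: "f (x + h) - f x \<ge> d * h - N * h\<^sup>2" if "\<bar>h\<bar> < \<delta>" for h
  proof -
    have "g x \<le> g (x + h)"
      using that by (intro xmin) (auto simp: \<delta>_def)
    then show ?thesis
      by (simp add: g_def d_def power2_eq_square algebra_simps)
  qed
  have above: "f (x + h) - f x \<le> d * h + N * h\<^sup>2" if h: "\<bar>h\<bar> < \<delta>" for h
  proof -
    have mem: "x \<in> {a<..<b}" "x + h \<in> {a<..<b}" "x - h \<in> {a<..<b}"
      using h ord x by (auto simp: \<delta>_def)
    \<comment> \<open>Midpoint concavity bounds the forward increment by the backward one, to which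
      \<open>below\<close> applies with \<open>- h\<close>.\<close>
    have "1/2 * f (x + h) + 1/2 * f (x - h) \<le> f ((1/2) *\<^sub>R (x + h) + (1/2) *\<^sub>R (x - h))"
      using f mem unfolding concave_on_iff by (meson field_sum_of_halves zero_le_divide_1_iff zero_le_numeral)
    also have "(1/2) *\<^sub>R (x + h) + (1/2) *\<^sub>R (x - h) = x"
      by (simp add: field_simps)
    finally have "f (x + h) - f x \<le> f x - f (x - h)"
      by simp
    with below[of "- h"] h show ?thesis
      by simp
  qed
  have "((\<lambda>h. (f (x + h) - f x) / h) \<longlongrightarrow> d) (at 0)"
  proof (rule LIM_I)
    fix r :: real assume "0 < r"
    define s where "s = min \<delta> (r / (N + 1))"
    have "norm ((f (x + h) - f x) / h - d) < r" if h: "h \<noteq> 0" "norm (h - 0) < s" for h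
    proof -
      have "\<bar>f (x + h) - f x - d * h\<bar> \<le> N * \<bar>h\<bar> * \<bar>h\<bar>"
        using below[of h] above[of h] h by (simp add: s_def power2_eq_square abs_le_iff mult.assoc)
      moreover have "(f (x + h) - f x) / h - d = (f (x + h) - f x - d * h) / h"
        using h by (simp add: diff_divide_distrib)
      ultimately have "\<bar>(f (x + h) - f x) / h - d\<bar> \<le> N * \<bar>h\<bar>"
        using h by (simp add: abs_divide pos_divide_le_eq)
      also have "\<dots> \<le> (N + 1) * \<bar>h\<bar>" by (simp add: algebra_simps)
      also have "\<dots> < r"
        using h N(1) by (simp add: s_def field_simps)
      finally show ?thesis by simp
    qed
    moreover have "s > 0" using \<open>0 < r\<close> \<delta> N(1) by (simp add: s_def)
    ultimately show "\<exists>s>0. \<forall>h. h \<noteq> 0 \<and> norm (h - 0) < s \<longrightarrow> norm ((f (x + h) - f x) / h - d) < r"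
      by blast
  qed
  then have "(f has_field_derivative d) (at x)"
    by (simp add: DERIV_def)
  then have "f differentiable (at x)"
    using real_differentiable_def by blast
  with x ord show ?thesis by auto
qed

section \<open>Monotone singular kernels\<close>

text \<open>Strict concavity is kept only as strictness of the two monotonicities. Singularity is
  phrased through real bounds near 0, so the value at 0 never enters.\<close>

locale monotone_kernel =
  fixes K :: "real \<Rightarrow> real"
  assumes concave_neg: "concave_on {..<0} K"
    and concave_pos: "concave_on {0<..} K"
    and decreasing_neg: "s < t \<Longrightarrow> t < 0 \<Longrightarrow> K t < K s"
    and increasing_pos: "0 < s \<Longrightarrow> s < t \<Longrightarrow> K s < K t"
    and singular_at_0: "\<exists>\<epsilon>>0. \<forall>t. t \<noteq> 0 \<and> \<bar>t\<bar> < \<epsilon> \<longrightarrow> K t \<le> B"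
begin

text \<open>Carries each estimate on the positive half-line over to the negative one.\<close>

lemma reflection: "monotone_kernel (\<lambda>t. K (- t))"
proof
  show "concave_on {..<0} (\<lambda>t. K (- t))" "concave_on {0<..} (\<lambda>t. K (- t))"
    unfolding concave_on_iff
  proof safe
    fix x y u v :: real assume uv: "0 \<le> u" "0 \<le> v" "u + v = 1"
    have eq: "- (u *\<^sub>R x + v *\<^sub>R y) = u *\<^sub>R (- x) + v *\<^sub>R (- y)" by simp
    show "u * K (- x) + v * K (- y) \<le> K (- (u *\<^sub>R x + v *\<^sub>R y))" if "x < 0" "y < 0"
      using concave_pos uv that unfolding concave_on_iff eq by (metis greaterThan_iff neg_0_less_iff_less)
    show "u * K (- x) + v * K (- y) \<le> K (- (u *\<^sub>R x + v *\<^sub>R y))" if "0 < x" "0 < y"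
      using concave_neg uv that unfolding concave_on_iff eq by (metis lessThan_iff neg_less_0_iff_less)
  qed
  show "\<exists>\<epsilon>>0. \<forall>t. t \<noteq> 0 \<and> \<bar>t\<bar> < \<epsilon> \<longrightarrow> K (- t) \<le> B" for B
    using singular_at_0[of B] by (metis abs_minus_cancel neg_equal_0_iff_equal)
qed (use decreasing_neg increasing_pos in auto)

lemma lower_bound_away:
  assumes "0 < \<delta>" "\<delta> \<le> \<bar>t\<bar>"
  shows "min (K \<delta>) (K (- \<delta>)) \<le> K t"
  using assms decreasing_neg[of t "- \<delta>"] increasing_pos[of \<delta> t]
  by (cases "t = \<delta>"; cases "t = - \<delta>"; cases "0 < t") (auto simp: min_def)

lemma upper_bound_within:
  assumes "t \<noteq> 0" "\<bar>t\<bar> \<le> a"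
  shows "K t \<le> max (K a) (K (- a))"
  using assms decreasing_neg[of "- a" t] increasing_pos[of t a]
  by (cases "t = a"; cases "t = - a"; cases "0 < t") (auto simp: max_def)

text \<open>The chord over \<open>[T, T + 1]\<close> rises strictly, and by concavity every chord
  further left is at least as steep.\<close>

lemma slope_lower_bound:
  assumes "0 < T"
  obtains c where "0 < c" "\<And>s t. 0 < s \<Longrightarrow> s \<le> t \<Longrightarrow> t \<le> T \<Longrightarrow> c * (t - s) \<le> K t - K s"
proof
  show "0 < K (T + 1) - K T"
    using assms increasing_pos by simp
  fix s t assume st: "0 < s" "s \<le> t" "t \<le> T"
  show "(K (T + 1) - K T) * (t - s) \<le> K t - K s"
  proof (cases "s = t")
    case False
    with st have "s < t" by simp
    with concave_on_slope_antimono[OF concave_pos, of s t T "T + 1"] st assms show ?thesis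
      by (simp add: field_simps)
  qed simp
qed

text \<open>The chord over \<open>[\<epsilon> / 2, \<epsilon>]\<close> is at least as steep as any
  chord to its right, and monotonicity bounds slopes below by 0.\<close>

lemma lipschitz_away_pos:
  assumes "0 < \<epsilon>"
  obtains L where "0 \<le> L" "\<And>s t. \<epsilon> \<le> s \<Longrightarrow> \<epsilon> \<le> t \<Longrightarrow> \<bar>K t - K s\<bar> \<le> L * \<bar>t - s\<bar>"
proof
  define L where "L = (K \<epsilon> - K (\<epsilon> / 2)) / (\<epsilon> - \<epsilon> / 2)"
  show "0 \<le> L"
    using assms increasing_pos[of "\<epsilon> / 2" \<epsilon>] by (simp add: L_def)
  have *: "\<bar>K t - K s\<bar> \<le> L * \<bar>t - s\<bar>" if "\<epsilon> \<le> s" "s < t" for s t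
  proof -
    have "(K t - K s) / (t - s) \<le> L"
      unfolding L_def using that assms by (intro concave_on_slope_antimono[OF concave_pos]) auto
    with that increasing_pos[of s t] assms show ?thesis
      by (simp add: field_simps)
  qed
  show "\<bar>K t - K s\<bar> \<le> L * \<bar>t - s\<bar>" if "\<epsilon> \<le> s" "\<epsilon> \<le> t" for s t
    using *[of s t] *[of t s] that by (cases s t rule: linorder_cases) (auto simp: abs_minus_commute)
qed

lemma lipschitz_away:
  assumes "0 < \<epsilon>"
  obtains L where "0 \<le> L"
    "\<And>s t. \<epsilon> \<le> \<bar>s\<bar> \<Longrightarrow> \<epsilon> \<le> \<bar>t\<bar> \<Longrightarrow> 0 < s \<longleftrightarrow> 0 < t \<Longrightarrow> \<bar>K t - K s\<bar> \<le> L * \<bar>t - s\<bar>"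
proof -
  obtain L1 where L1: "0 \<le> L1" "\<And>s t. \<epsilon> \<le> s \<Longrightarrow> \<epsilon> \<le> t \<Longrightarrow> \<bar>K t - K s\<bar> \<le> L1 * \<bar>t - s\<bar>"
    using lipschitz_away_pos[OF assms] by blast
  obtain L2 where L2: "0 \<le> L2"
    "\<And>s t. \<epsilon> \<le> s \<Longrightarrow> \<epsilon> \<le> t \<Longrightarrow> \<bar>K (- t) - K (- s)\<bar> \<le> L2 * \<bar>t - s\<bar>"
    using monotone_kernel.lipschitz_away_pos[OF reflection assms] by blast
  show ?thesis
  proof (rule that[of "max L1 L2"])
    fix s t assume st: "\<epsilon> \<le> \<bar>s\<bar>" "\<epsilon> \<le> \<bar>t\<bar>" "0 < s \<longleftrightarrow> 0 < t"
    have "\<bar>K t - K s\<bar> \<le> L1 * \<bar>t - s\<bar> \<or> \<bar>K t - K s\<bar> \<le> L2 * \<bar>t - s\<bar>"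
      using L1(2)[of s t] L2(2)[of "- s" "- t"] st by (cases "0 < s") (auto simp: abs_minus_commute)
    moreover have "L1 * \<bar>t - s\<bar> \<le> max L1 L2 * \<bar>t - s\<bar>" "L2 * \<bar>t - s\<bar> \<le> max L1 L2 * \<bar>t - s\<bar>"
      by (simp_all add: mult_right_mono)
    ultimately show "\<bar>K t - K s\<bar> \<le> max L1 L2 * \<bar>t - s\<bar>" by linarith
  qed (use L1 in simp)
qed

text \<open>A translated kernel is controlled by the untranslated one, with \<open>C\<close>
  independent of \<open>y\<close>. No bound by \<open>K t + C\<close> alone can be expected when
  \<open>y\<close> is far away; the term \<open>K (t0 - y)\<close> absorbs the excess. The cases
  follow the position of \<open>y\<close>: monotonicity suffices while \<open>y\<close> is right of
  \<open>t\<close> or between 0 and \<open>t\<close>, and for negative \<open>y\<close> concavity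
  moves the increment by \<open>- y\<close> from \<open>t\<close> back to 1.\<close>

lemma translate_bound_pos:
  assumes "0 < \<delta>" "0 \<le> P"
  obtains C where "\<And>y t0 t. \<bar>t0\<bar> \<le> P \<Longrightarrow> \<delta> \<le> \<bar>t0 - y\<bar> \<Longrightarrow> P + 1 \<le> t \<Longrightarrow> t \<noteq> y \<Longrightarrow>
    K (t - y) \<le> K (t0 - y) + K t + C"
proof
  define m where "m = min (K \<delta>) (K (- \<delta>))"
  fix y t0 t :: real
  assume t0: "\<bar>t0\<bar> \<le> P" "\<delta> \<le> \<bar>t0 - y\<bar>" and t: "P + 1 \<le> t" "t \<noteq> y"
  have m: "m \<le> K (t0 - y)"
    unfolding m_def using assms t0 by (intro lower_bound_away) auto
  have K1: "K 1 \<le> K t"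
    using increasing_pos[of 1 t] t assms by (cases "t = 1") auto
  have KP: "K 1 \<le> K (P + 2)"
    using increasing_pos[of 1 "P + 2"] assms by simp
  consider "t < y" | "0 \<le> y" "y < t" | "y < 0" "- (P + 1) < y" | "y \<le> - (P + 1)"
    using t by linarith
  then show "K (t - y) \<le> K (t0 - y) + K t + (\<bar>m\<bar> + \<bar>K (P + 2)\<bar> + 2 * \<bar>K 1\<bar>)"
  proof cases
    case 1
    have "t0 < t" using t t0 by linarith
    with 1 have "K (t - y) \<le> K (t0 - y)"
      using decreasing_neg[of "t0 - y" "t - y"] by simp
    with K1 show ?thesis by linarith
  next
    case 2
    then have "K (t - y) \<le> K t"
      using increasing_pos[of "t - y" t] by (cases "y = 0") auto
    with m show ?thesis by linarith
  next
    case 3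
    have "K (t + - y) - K t \<le> K (1 + - y) - K 1"
      using 3 t assms by (intro concave_on_increment_antimono[OF concave_pos]) auto
    moreover have "K (1 - y) \<le> K (P + 2)"
      using increasing_pos[of "1 - y" "P + 2"] 3 by simp
    ultimately show ?thesis using m by simp
  next
    \<comment> \<open>Here \<open>K (1 - y)\<close> may be unbounded. Its argument exceeds
      \<open>t0 - y\<close> by at most \<open>P + 1\<close>, so by concavity the excess over
      \<open>K (t0 - y)\<close> is at most \<open>K (P + 2) - K 1\<close>.\<close>
    case 4
    then have ge1: "1 \<le> t0 - y" using t0 by linarith
    have "K (t + - y) - K t \<le> K (1 + - y) - K 1"
      using 4 t assms by (intro concave_on_increment_antimono[OF concave_pos]) auto
    moreover have "K (1 - y) \<le> K (t0 - y + (P + 1))"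
    proof (cases "1 - y = t0 - y + (P + 1)")
      case True
      show ?thesis unfolding True ..
    next
      case False
      moreover have "1 - y \<le> t0 - y + (P + 1)" "0 < 1 - y" using t0(1) 4 assms(2) by linarith+
      ultimately show ?thesis using increasing_pos[of "1 - y" "t0 - y + (P + 1)"] by simp
    qed
    moreover have "K (t0 - y + (P + 1)) - K (t0 - y) \<le> K (1 + (P + 1)) - K 1"
      using ge1 assms by (intro concave_on_increment_antimono[OF concave_pos]) auto
    moreover have "1 + (P + 1) = P + 2" by simp
    ultimately show ?thesis by (simp only: diff_conv_add_uminus[symmetric])
  qed
qed

lemma translate_bound:
  assumes "0 < \<delta>" "0 \<le> P"
  obtains C where "\<And>y t0 t. \<bar>t0\<bar> \<le> P \<Longrightarrow> \<delta> \<le> \<bar>t0 - y\<bar> \<Longrightarrow> P + 1 \<le> \<bar>t\<bar> \<Longrightarrow> t \<noteq> y \<Longrightarrow>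
    K (t - y) \<le> K (t0 - y) + K t + C"
proof -
  obtain C1 where C1: "\<And>y t0 t. \<bar>t0\<bar> \<le> P \<Longrightarrow> \<delta> \<le> \<bar>t0 - y\<bar> \<Longrightarrow> P + 1 \<le> t \<Longrightarrow> t \<noteq> y \<Longrightarrow>
      K (t - y) \<le> K (t0 - y) + K t + C1"
    using translate_bound_pos[OF assms] by blast
  obtain C2 where C2: "\<And>y t0 t. \<bar>t0\<bar> \<le> P \<Longrightarrow> \<delta> \<le> \<bar>t0 - y\<bar> \<Longrightarrow> P + 1 \<le> t \<Longrightarrow> t \<noteq> y \<Longrightarrow>
      K (- (t - y)) \<le> K (- (t0 - y)) + K (- t) + C2"
    using monotone_kernel.translate_bound_pos[OF reflection assms] by blast
  show ?thesis
  proof (rule that[of "max C1 C2"])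
    fix y t0 t :: real
    assume *: "\<bar>t0\<bar> \<le> P" "\<delta> \<le> \<bar>t0 - y\<bar>" "P + 1 \<le> \<bar>t\<bar>" "t \<noteq> y"
    show "K (t - y) \<le> K (t0 - y) + K t + max C1 C2"
    proof (cases "0 \<le> t")
      case True
      with C1[of t0 y t] * show ?thesis by simp
    next
      case False
      with C2[of "- t0" "- y" "- t"] * show ?thesis by (simp add: abs_minus_commute)
    qed
  qed
qed

end

section \<open>Ranks of indices\<close>

lemma card_atMost_le_iff [simp]:
  fixes l k :: "'n::{finite,linorder}"
  shows "card {..l} \<le> card {..k} \<longleftrightarrow> l \<le> k"
proof
  assume "card {..l} \<le> card {..k}"
  show "l \<le> k"
  proof (rule ccontr)
    assume "\<not> l \<le> k"
    then have "{..k} \<subset> {..l}" by auto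
    then have "card {..k} < card {..l}" by (intro psubset_card_mono) auto
    with \<open>card {..l} \<le> card {..k}\<close> show False by simp
  qed
qed (auto intro!: card_mono)

lemma card_atMost_bounds:
  fixes l :: "'n::{finite,linorder}"
  shows "1 \<le> card {..l}" "card {..l} \<le> CARD('n)"
  using bij_betw_card_atMost[where 'n='n] by (auto simp: bij_betw_def)

lemma card_lessThan_eq:
  fixes l :: "'n::{finite,linorder}"
  shows "card {..<l} = card {..l} - 1"
proof -
  have "{..l} = insert l {..<l}" by auto
  then show ?thesis by simp
qed

lemma ex_rank:
  assumes "1 \<le> j" "j \<le> CARD('n)"
  obtains k :: "'n::{finite,linorder}" where "card {..k} = j"
  using card_atMost_nth_index[OF assms] by blast

lemma sum_rank_telescope:
  fixes m :: "nat \<Rightarrow> real"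
  shows "(\<Sum>k::'n::{finite,linorder}\<in>UNIV. m (card {..k}) - m (card {..<k})) = m (CARD('n)) - m 0"
proof -
  have "(\<Sum>k::'n\<in>UNIV. m (card {..k}) - m (card {..<k})) =
      (\<Sum>j\<in>{1..CARD('n)}. m j - m (j - 1))"
    unfolding card_lessThan_eq
    by (rule sum.reindex_bij_betw[OF bij_betw_card_atMost, where g = "\<lambda>j. m j - m (j - 1)"])
  also have "\<dots> = (\<Sum>j\<in>{Suc 0..CARD('n)}. m j - m (j - 1))" by simp
  also have "\<dots> = m (CARD('n)) - m 0"
    using sum_telescope''[of 0 "CARD('n)" m] by simp
  finally show ?thesis .
qed

section \<open>Sums of translates\<close>

text \<open>
  \<open>S\<close> is the set where the field is finite, and \<open>finite_points y j\<close> consists of the points of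
  the \<open>j\<close>-th node interval at which the sum of translates is finite. Nonemptiness of all these sets
  forces the coordinates of \<open>y\<close> to be strictly increasing.
\<close>

locale translates_system =
  fixes K :: "'n::{finite,linorder} \<Rightarrow> real \<Rightarrow> real" and J :: "real \<Rightarrow> real" and S :: "real set"
  assumes kernels: "\<And>l. monotone_kernel (K l)"
    and field_bounded: "\<exists>M. \<forall>t\<in>S. \<bar>t\<bar> \<le> a \<longrightarrow> J t \<le> M"
    and field_decay: "\<exists>T. \<forall>t\<in>S. T \<le> \<bar>t\<bar> \<longrightarrow> J t + (\<Sum>l\<in>UNIV. K l t) \<le> B"
    and many_points: "infinite S \<or> CARD('n) < card S"
begin

definition finite_points :: "real ^ 'n::{finite,linorder} \<Rightarrow> nat \<Rightarrow> real set" where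
  "finite_points y j = {t\<in>S. \<forall>l. if card {..l} \<le> j then y $ l < t else t < y $ l}"

definition F :: "real ^ 'n::{finite,linorder} \<Rightarrow> real \<Rightarrow> real" where
  "F y t = J t + (\<Sum>l\<in>UNIV. K l (t - y $ l))"

definition m :: "nat \<Rightarrow> real ^ 'n::{finite,linorder} \<Rightarrow> real" where
  "m j y = (SUP t\<in>finite_points y j. F y t)"

definition R :: "(real ^ 'n::{finite,linorder}) set" where
  "R = {y. \<forall>j\<le>CARD('n). finite_points y j \<noteq> {}}"

definition D :: "real ^ 'n::{finite,linorder} \<Rightarrow> real ^ 'n::{finite,linorder}" where
  "D y = (\<chi> k. m (card {..k}) y - m (card {..<k}) y)"

lemma finite_pointsD:
  assumes "t \<in> finite_points y j"
  shows "t \<in> S" "card {..l} \<le> j \<Longrightarrow> y $ l < t" "j < card {..l} \<Longrightarrow> t < y $ l" "t \<noteq> y $ l"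
  using assms unfolding finite_points_def by (auto split: if_splits dest!: spec[of _ l])

lemma finite_pointsI:
  assumes "t \<in> S" "\<And>l. card {..l} \<le> j \<Longrightarrow> y $ l < t" "\<And>l. j < card {..l} \<Longrightarrow> t < y $ l"
  shows "t \<in> finite_points y j"
  using assms unfolding finite_points_def by auto

text \<open>A finite point of the interval just right of \<open>y $ i\<close> separates the two
  nodes.\<close>

lemma R_imp_strict_mono:
  assumes "y \<in> R" "i < k"
  shows "y $ i < y $ k"
proof -
  obtain t where t: "t \<in> finite_points y (card {..i})"
    using assms(1) card_atMost_bounds[of i] unfolding R_def by blast
  have "card {..i} < card {..k}" using assms(2) by (simp add: not_le[symmetric])
  with finite_pointsD(2)[OF t, of i] finite_pointsD(3)[OF t, of k] show ?thesis by simp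
qed

lemma R_imp_mono: "y \<in> R \<Longrightarrow> i \<le> k \<Longrightarrow> y $ i \<le> y $ k"
  using R_imp_strict_mono[of y i k] by (cases "i = k") (auto simp: order.order_iff_strict)

lemma mono_imp_finite_points:
  assumes mono: "\<And>i k. i \<le> k \<Longrightarrow> y $ i \<le> y $ k" and t: "t \<in> S" "\<And>l. t \<noteq> y $ l"
  obtains j where "j \<le> CARD('n)" "t \<in> finite_points y j"
proof (cases "{l. y $ l < t} = {}")
  case True
  have "t \<in> finite_points y 0"
    using True t card_atMost_bounds(1) by (intro finite_pointsI) (auto simp: not_less order.order_iff_strict)
  then show ?thesis by (intro that) auto
next
  case False
  define k where "k = Max {l. y $ l < t}"
  have k: "y $ k < t" "\<And>l. y $ l < t \<Longrightarrow> l \<le> k"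
    using Max_in[of "{l. y $ l < t}"] False by (auto simp: k_def)
  have "t \<in> finite_points y (card {..k})"
  proof (rule finite_pointsI)
    show "y $ l < t" if "card {..l} \<le> card {..k}" for l
      using mono[of l k] that k(1) by simp
    show "t < y $ l" if "card {..k} < card {..l}" for l
      using k(2)[of l] that t(2)[of l] card_atMost_le_iff[of l k] by linarith
  qed (fact t)
  then show ?thesis using card_atMost_bounds by (intro that)
qed

subsection \<open>Near maximizers\<close>

text \<open>Summing \<open>translate_bound\<close> over the kernels bounds \<open>F y t\<close> by
  the untranslated sum at \<open>t\<close>, plus the kernel terms of \<open>F y t0\<close>, plus a
  constant. Comparison with \<open>F y t0\<close> cancels those kernel terms, and decay of the field
  excludes large \<open>t\<close>. Hence \<open>T\<close> does not depend on
  \<open>y\<close>.\<close>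

lemma window:
  assumes "0 < \<delta>" "0 \<le> P"
  obtains T where "0 \<le> T" "\<And>y t0 t. - P \<le> J t0 \<Longrightarrow> \<bar>t0\<bar> \<le> P \<Longrightarrow> (\<And>l. \<delta> \<le> \<bar>t0 - y $ l\<bar>) \<Longrightarrow>
    t \<in> S \<Longrightarrow> (\<And>l. t \<noteq> y $ l) \<Longrightarrow> F y t0 - B \<le> F y t \<Longrightarrow> \<bar>t\<bar> \<le> T"
proof -
  have "\<exists>C. \<forall>y t0 t. \<bar>t0\<bar> \<le> P \<longrightarrow> \<delta> \<le> \<bar>t0 - y\<bar> \<longrightarrow> P + 1 \<le> \<bar>t\<bar> \<longrightarrow> t \<noteq> y \<longrightarrow>
    K l (t - y) \<le> K l (t0 - y) + K l t + C" for l
    using monotone_kernel.translate_bound[OF kernels assms] by metis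
  then obtain C where C: "\<And>l y t0 t. \<bar>t0\<bar> \<le> P \<Longrightarrow> \<delta> \<le> \<bar>t0 - y\<bar> \<Longrightarrow> P + 1 \<le> \<bar>t\<bar> \<Longrightarrow> t \<noteq> y \<Longrightarrow>
    K l (t - y) \<le> K l (t0 - y) + K l t + C l"
    by metis
  obtain T where T: "\<And>t. t \<in> S \<Longrightarrow> T \<le> \<bar>t\<bar> \<Longrightarrow> J t + (\<Sum>l\<in>UNIV. K l t) \<le> - P - B - (\<Sum>l\<in>UNIV. C l) - 1"
    using field_decay by blast
  show ?thesis
  proof (rule that[of "max T (P + 1)"])
    fix y t0 t
    assume t0: "- P \<le> J t0" "\<bar>t0\<bar> \<le> P" "\<And>l. \<delta> \<le> \<bar>t0 - y $ l\<bar>"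
      and t: "t \<in> S" "\<And>l. t \<noteq> y $ l" "F y t0 - B \<le> F y t"
    show "\<bar>t\<bar> \<le> max T (P + 1)"
    proof (rule ccontr)
      assume "\<not> \<bar>t\<bar> \<le> max T (P + 1)"
      then have big: "T \<le> \<bar>t\<bar>" "P + 1 \<le> \<bar>t\<bar>" by auto
      have "(\<Sum>l\<in>UNIV. K l (t - y $ l)) \<le> (\<Sum>l\<in>UNIV. K l (t0 - y $ l) + K l t + C l)"
        using C t0 t big by (intro sum_mono) auto
      also have "\<dots> = (\<Sum>l\<in>UNIV. K l (t0 - y $ l)) + (\<Sum>l\<in>UNIV. K l t) + (\<Sum>l\<in>UNIV. C l)"
        by (simp add: sum.distrib)
      finally show False
        using T[OF t(1) big(1)] t(3) t0(1) by (simp add: F_def)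
    qed
  qed (use assms in auto)
qed

text \<open>On bounded sets the field and all kernels but one are bounded above; the remaining
  kernel drives \<open>F\<close> to minus infinity at its node.\<close>

lemma F_le_kernel:
  obtains C where "\<And>y t l. t \<in> S \<Longrightarrow> \<bar>t\<bar> \<le> T \<Longrightarrow> (\<And>l. t \<noteq> y $ l) \<Longrightarrow> (\<And>l. \<bar>y $ l\<bar> \<le> Y) \<Longrightarrow>
    F y t \<le> K l (t - y $ l) + C"
proof -
  obtain M where M: "\<And>t. t \<in> S \<Longrightarrow> \<bar>t\<bar> \<le> T \<Longrightarrow> J t \<le> M"
    using field_bounded by blast
  \<comment> \<open>The absolute value makes the bounds nonnegative, so restoring the omitted index
    only enlarges the sum and the constant serves every \<open>l\<close>.\<close>
  define u where "u l = \<bar>max (K l (T + Y)) (K l (- (T + Y)))\<bar>" for l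
  show ?thesis
  proof (rule that[of "M + (\<Sum>l\<in>UNIV. u l)"])
    fix y :: "real ^ 'n::{finite,linorder}" and t l
    assume *: "t \<in> S" "\<bar>t\<bar> \<le> T" "\<And>l. t \<noteq> y $ l" "\<And>l. \<bar>y $ l\<bar> \<le> Y"
    have le: "K k (t - y $ k) \<le> u k" for k
    proof -
      have "\<bar>t - y $ k\<bar> \<le> T + Y" using *(2) *(4)[of k] by linarith
      with monotone_kernel.upper_bound_within[OF kernels, of "t - y $ k" "T + Y" k] *(3)[of k]
      show ?thesis by (simp add: u_def)
    qed
    have "(\<Sum>k\<in>UNIV. K k (t - y $ k)) = K l (t - y $ l) + (\<Sum>k\<in>UNIV - {l}. K k (t - y $ k))"
      by (simp add: sum.remove)
    also have "(\<Sum>k\<in>UNIV - {l}. K k (t - y $ k)) \<le> (\<Sum>k\<in>UNIV - {l}. u k)"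
      by (intro sum_mono le)
    also have "\<dots> \<le> (\<Sum>k\<in>UNIV. u k)"
      by (intro sum_mono2) (auto simp: u_def)
    finally show "F y t \<le> K l (t - y $ l) + (M + (\<Sum>l\<in>UNIV. u l))"
      using M[OF *(1,2)] by (simp add: F_def)
  qed
qed

text \<open>By \<open>window\<close> the competing points are bounded, so \<open>F\<close> there is
  at most one kernel plus a constant. At the test point \<open>F\<close> is bounded below because
  the kernels are evaluated at distance at least \<open>\<delta>\<close> from 0. A point too close
  to a node would thus fall more than \<open>B\<close> behind.\<close>

lemma gap:
  assumes "0 < \<delta>" "0 \<le> P"
  obtains \<epsilon> where "0 < \<epsilon>"
    "\<And>y t0 t l. - P \<le> J t0 \<Longrightarrow> \<bar>t0\<bar> \<le> P \<Longrightarrow> (\<And>l. \<delta> \<le> \<bar>t0 - y $ l\<bar>) \<Longrightarrow> (\<And>l. \<bar>y $ l\<bar> \<le> Y) \<Longrightarrow>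
      t \<in> S \<Longrightarrow> (\<And>l. t \<noteq> y $ l) \<Longrightarrow> F y t0 - B \<le> F y t \<Longrightarrow> \<epsilon> \<le> \<bar>t - y $ l\<bar>"
proof -
  obtain T where T: "\<And>y t0 t. - P \<le> J t0 \<Longrightarrow> \<bar>t0\<bar> \<le> P \<Longrightarrow> (\<And>l. \<delta> \<le> \<bar>t0 - y $ l\<bar>) \<Longrightarrow>
    t \<in> S \<Longrightarrow> (\<And>l. t \<noteq> y $ l) \<Longrightarrow> F y t0 - B \<le> F y t \<Longrightarrow> \<bar>t\<bar> \<le> T"
    using window[OF assms] by blast
  obtain C where C: "\<And>y t l. t \<in> S \<Longrightarrow> \<bar>t\<bar> \<le> T \<Longrightarrow> (\<And>l. t \<noteq> y $ l) \<Longrightarrow> (\<And>l. \<bar>y $ l\<bar> \<le> Y) \<Longrightarrow>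
    F y t \<le> K l (t - y $ l) + C"
    using F_le_kernel by blast
  \<comment> \<open>The level that \<open>K l (t - y $ l)\<close> has to exceed if
    \<open>F y t\<close> is to reach \<open>F y t0 - B\<close>; subtracting 1 makes this
    strict.\<close>
  define A where "A = - P + (\<Sum>l\<in>UNIV. min (K l \<delta>) (K l (- \<delta>))) - B - C - 1"
  have "\<exists>\<epsilon>>0. \<forall>t. t \<noteq> 0 \<and> \<bar>t\<bar> < \<epsilon> \<longrightarrow> K l t \<le> A" for l
    by (rule monotone_kernel.singular_at_0[OF kernels])
  then obtain e where e: "\<And>l. 0 < e l" "\<And>l t. t \<noteq> 0 \<Longrightarrow> \<bar>t\<bar> < e l \<Longrightarrow> K l t \<le> A"
    by metis
  show ?thesis
  proof (rule that[of "Min (range e)"])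
    show "0 < Min (range e)" using e(1) by (auto simp: Min_gr_iff)
    fix y t0 t l
    assume t0: "- P \<le> J t0" "\<bar>t0\<bar> \<le> P" "\<And>l. \<delta> \<le> \<bar>t0 - y $ l\<bar>" and y: "\<And>l. \<bar>y $ l\<bar> \<le> Y"
      and t: "t \<in> S" "\<And>l. t \<noteq> y $ l" "F y t0 - B \<le> F y t"
    have "\<bar>t\<bar> \<le> T" using T t0 t by blast
    then have up: "F y t \<le> K l (t - y $ l) + C" using C t y by blast
    have "(\<Sum>l\<in>UNIV. min (K l \<delta>) (K l (- \<delta>))) \<le> (\<Sum>l\<in>UNIV. K l (t0 - y $ l))"
      using monotone_kernel.lower_bound_away[OF kernels assms(1) t0(3)] by (intro sum_mono)
    with t0(1) have "- P + (\<Sum>l\<in>UNIV. min (K l \<delta>) (K l (- \<delta>))) \<le> F y t0"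
      by (simp add: F_def)
    with up t(3) have "A < K l (t - y $ l)" by (simp add: A_def)
    with e(2)[of "t - y $ l" l] t(2)[of l] have "e l \<le> \<bar>t - y $ l\<bar>" by force
    moreover have "Min (range e) \<le> e l" by (intro Min_le) auto
    ultimately show "Min (range e) \<le> \<bar>t - y $ l\<bar>" by (rule order_trans[rotated])
  qed
qed

section \<open>Finiteness and near attainment of the suprema\<close>

lemma finite_min_distance:
  assumes "\<And>l. t \<noteq> (y :: real ^ 'n::{finite,linorder}) $ l"
  obtains \<delta> where "0 < \<delta>" "\<And>l. \<delta> \<le> \<bar>t - y $ l\<bar>"
proof
  show "0 < Min (range (\<lambda>l. \<bar>t - y $ l\<bar>))" using assms by (auto simp: Min_gr_iff)
qed (auto intro: Min_le)

lemma bdd_above_F: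
  assumes "t0 \<in> S" "\<And>l. t0 \<noteq> y $ l"
  shows "bdd_above (F y ` (S - range (($) y)))"
proof -
  obtain \<delta> where \<delta>: "0 < \<delta>" "\<And>l. \<delta> \<le> \<bar>t0 - y $ l\<bar>"
    using finite_min_distance[OF assms(2)] by blast
  define P where "P = max \<bar>t0\<bar> \<bar>J t0\<bar>"
  have P: "0 \<le> P" "- P \<le> J t0" "\<bar>t0\<bar> \<le> P" by (auto simp: P_def)
  obtain T where T: "\<And>t. t \<in> S \<Longrightarrow> (\<And>l. t \<noteq> y $ l) \<Longrightarrow> F y t0 - 0 \<le> F y t \<Longrightarrow> \<bar>t\<bar> \<le> T"
    by (rule window[OF \<delta>(1) P(1), where B = 0]) (use P \<delta>(2) in blast)
  define Y where "Y = Max (range (\<lambda>l. \<bar>y $ l\<bar>))"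
  have Y: "\<bar>y $ l\<bar> \<le> Y" for l by (auto simp: Y_def)
  obtain C where C: "\<And>t l. t \<in> S \<Longrightarrow> \<bar>t\<bar> \<le> T \<Longrightarrow> (\<And>l. t \<noteq> y $ l) \<Longrightarrow> F y t \<le> K l (t - y $ l) + C"
    by (rule F_le_kernel[of T Y]) (use Y in blast)
  define l :: 'n where "l = undefined"
  define U where "U = max (K l (T + Y)) (K l (- (T + Y)))"
  show ?thesis
  proof (rule bdd_aboveI2)
    fix t assume t: "t \<in> S - range (($) y)"
    show "F y t \<le> max (F y t0) (U + C)"
    proof (cases "F y t0 \<le> F y t")
      case True
      with t have "\<bar>t\<bar> \<le> T" by (intro T) auto
      moreover from this have "F y t \<le> K l (t - y $ l) + C"
        using t by (intro C) auto
      moreover have "K l (t - y $ l) \<le> U"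
        unfolding U_def using t \<open>\<bar>t\<bar> \<le> T\<close> Y[of l]
        by (intro monotone_kernel.upper_bound_within[OF kernels]) auto
      ultimately show ?thesis by simp
    qed simp
  qed
qed

lemma bdd_above_finite_points: "bdd_above (F y ` finite_points y j)"
proof (cases "finite_points y j = {}")
  case False
  then obtain t where "t \<in> finite_points y j" by blast
  then have "bdd_above (F y ` (S - range (($) y)))"
    using finite_pointsD by (intro bdd_above_F)
  then show ?thesis
    by (rule bdd_above_mono) (auto dest: finite_pointsD)
qed simp

lemma F_le_m: "t \<in> finite_points y j \<Longrightarrow> F y t \<le> m j y"
  unfolding m_def by (intro cSUP_upper bdd_above_finite_points)

lemma m_leI: "finite_points y j \<noteq> {} \<Longrightarrow> (\<And>t. t \<in> finite_points y j \<Longrightarrow> F y t \<le> B) \<Longrightarrow> m j y \<le> B"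
  unfolding m_def by (intro cSUP_least)

lemma near_maximizer:
  assumes "finite_points y j \<noteq> {}" "0 < e"
  obtains t where "t \<in> finite_points y j" "m j y - e < F y t"
proof -
  have "m j y - e < (SUP t\<in>finite_points y j. F y t)"
    using assms(2) by (simp add: m_def)
  with assms(1) bdd_above_finite_points show ?thesis
    by (auto simp: less_cSUP_iff intro: that)
qed

text \<open>Since suprema need not be attained, this reduces a bound on one to points within 1 of
  it, to which \<open>window\<close> and \<open>gap\<close> apply.\<close>

lemma m_le_by_near_maximizers:
  assumes "finite_points y j \<noteq> {}"
    and "\<And>t. t \<in> finite_points y j \<Longrightarrow> m j y - 1 \<le> F y t \<Longrightarrow> F y t \<le> B"
  shows "m j y \<le> B"
proof (rule field_le_epsilon)
  fix e :: real assume "0 < e"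
  obtain t where t: "t \<in> finite_points y j" "m j y - min e 1 < F y t"
    using near_maximizer[OF assms(1), of "min e 1"] \<open>0 < e\<close> by auto
  with assms(2)[of t] show "m j y \<le> B + e" by (auto simp: min_def split: if_splits)
qed
subsection \<open>Monotonicity of the difference function\<close>

lemma finite_points_first_mono:
  assumes "\<And>l. x $ l \<le> z $ l"
  shows "finite_points x 0 \<subseteq> finite_points z 0"
proof
  fix t assume t: "t \<in> finite_points x 0"
  show "t \<in> finite_points z 0"
  proof (rule finite_pointsI)
    show "t < z $ l" if "0 < card {..l}" for l
      using finite_pointsD(3)[OF t that] assms[of l] by simp
  qed (use finite_pointsD(1)[OF t] in auto)
qed

lemma finite_points_last_antimono:
  assumes "\<And>l. x $ l \<le> z $ l"
  shows "finite_points z (CARD('n)) \<subseteq> finite_points x (CARD('n))"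
proof
  fix t assume t: "t \<in> finite_points z (CARD('n))"
  show "t \<in> finite_points x (CARD('n))"
  proof (rule finite_pointsI)
    show "x $ l < t" if "card {..l} \<le> CARD('n)" for l
      using finite_pointsD(2)[OF t that] assms[of l] by simp
    show "t < x $ l" if "CARD('n) < card {..l}" for l
      using card_atMost_bounds(2)[of l] that by simp
  qed (fact finite_pointsD(1)[OF t])
qed

text \<open>The interval starts at the fixed node, and the nodes bounding it on the right can only
  recede.\<close>

lemma finite_points_right_of_fixed:
  assumes le: "\<And>l. x $ l \<le> z $ l" and mono: "\<And>i k. i \<le> k \<Longrightarrow> z $ i \<le> z $ k" and eq: "x $ k = z $ k"
  shows "finite_points x (card {..k}) \<subseteq> finite_points z (card {..k})"
proof
  fix t assume t: "t \<in> finite_points x (card {..k})"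
  show "t \<in> finite_points z (card {..k})"
  proof (rule finite_pointsI)
    show "t \<in> S" using finite_pointsD(1)[OF t] .
    show "z $ l < t" if "card {..l} \<le> card {..k}" for l
      using mono[of l k] that finite_pointsD(2)[OF t, of k] eq by simp
    show "t < z $ l" if "card {..k} < card {..l}" for l
      using finite_pointsD(3)[OF t that] le[of l] by simp
  qed
qed

lemma finite_points_left_of_fixed:
  assumes le: "\<And>l. x $ l \<le> z $ l" and mono: "\<And>i k. i \<le> k \<Longrightarrow> x $ i \<le> x $ k" and eq: "x $ k = z $ k"
  shows "finite_points z (card {..<k}) \<subseteq> finite_points x (card {..<k})"
proof
  fix t assume t: "t \<in> finite_points z (card {..<k})"
  have less: "card {..<k} < card {..l} \<longleftrightarrow> k \<le> l" for l
    unfolding card_lessThan_eq using card_atMost_bounds(1)[of k] card_atMost_le_iff[of k l] by linarith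
  show "t \<in> finite_points x (card {..<k})"
  proof (rule finite_pointsI)
    show "t \<in> S" using finite_pointsD(1)[OF t] .
    show "x $ l < t" if "card {..l} \<le> card {..<k}" for l
      using finite_pointsD(2)[OF t that] le[of l] by simp
    show "t < x $ l" if "card {..<k} < card {..l}" for l
      using mono[of k l] that finite_pointsD(3)[OF t, of k] eq unfolding less by simp
  qed
qed

text \<open>
  If only nodes different from \<open>y\<^sub>k\<close> move, and they move to the right, then by concavity the sum of
  translates grows at least as much right of \<open>y\<^sub>k\<close> as left of it, the two points
  lying on the same side of each moving node throughout. Only the intervals adjacent to \<open>y\<^sub>k\<close> matter,
  and they change in the favourable direction.
\<close>

lemma D_mono_at_fixed_node:
  assumes R: "x \<in> R" "z \<in> R" and le: "\<And>l. x $ l \<le> z $ l" and eq: "x $ k = z $ k"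
  shows "D x $ k \<le> D z $ k"
proof -
  let ?r = "card {..k}" and ?q = "card {..<k}"
  have q: "?q < ?r" "?q = ?r - 1" using card_atMost_bounds(1)[of k] by (auto simp: card_lessThan_eq)
  have card: "?r \<le> CARD('n)" "?q \<le> CARD('n)" using card_atMost_bounds(2)[of k] q by auto
  have ne: "finite_points x ?r \<noteq> {}" "finite_points z ?q \<noteq> {}"
    using R card by (auto simp: R_def)
  note sub = finite_points_right_of_fixed[OF le R_imp_mono[OF R(2)] eq]
    finite_points_left_of_fixed[OF le R_imp_mono[OF R(1)] eq]
  \<comment> \<open>Taking suprema over \<open>t\<close> and \<open>s\<close> on the left gives
    \<open>m ?r x + m ?q z\<close>, while the right is at most \<open>m ?r z + m ?q x\<close>.
    Rearranged, this is the claim.\<close>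
  have exchange: "F x t + F z s \<le> F z t + F x s"
    if t: "t \<in> finite_points x ?r" and s: "s \<in> finite_points z ?q" for s t
  proof -
    have t': "t \<in> finite_points z ?r" and s': "s \<in> finite_points x ?q"
      using sub s t by auto
    have "s < z $ k" "x $ k < t" using finite_pointsD s t q(1) by blast+
    with eq have "s < t" by simp
    have "K l (t - x $ l) + K l (s - z $ l) \<le> K l (t - z $ l) + K l (s - x $ l)" for l
    proof -
      have h: "s - z $ l + (z $ l - x $ l) = s - x $ l" "t - z $ l + (z $ l - x $ l) = t - x $ l"
        by auto
      have "l = k \<or> card {..l} \<le> ?q \<or> ?r < card {..l}"
      proof -
        have "l = k \<or> \<not> card {..k} \<le> card {..l} \<or> \<not> card {..l} \<le> card {..k}"
          unfolding card_atMost_le_iff by auto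
        with q show ?thesis by linarith
      qed
      then consider "l = k" | "card {..l} \<le> ?q" | "?r < card {..l}" by blast
      then show ?thesis
      proof cases
        case 1 then show ?thesis using eq by simp
      next
        case 2
        then have "z $ l < s" "x $ l < s" using finite_pointsD(2) s s' by auto
        then have "K l (t - z $ l + (z $ l - x $ l)) - K l (t - z $ l)
            \<le> K l (s - z $ l + (z $ l - x $ l)) - K l (s - z $ l)"
          using \<open>s < t\<close> le[of l]
          by (intro concave_on_increment_antimono[OF monotone_kernel.concave_pos[OF kernels]]) auto
        then show ?thesis unfolding h by simp
      next
        case 3
        then have "t < z $ l" "t < x $ l" using finite_pointsD(3) t t' by auto
        then have "K l (t - z $ l + (z $ l - x $ l)) - K l (t - z $ l)
            \<le> K l (s - z $ l + (z $ l - x $ l)) - K l (s - z $ l)"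
          using \<open>s < t\<close> le[of l]
          by (intro concave_on_increment_antimono[OF monotone_kernel.concave_neg[OF kernels]]) auto
        then show ?thesis unfolding h by simp
      qed
    qed
    then have "(\<Sum>l\<in>UNIV. K l (t - x $ l) + K l (s - z $ l)) \<le> (\<Sum>l\<in>UNIV. K l (t - z $ l) + K l (s - x $ l))"
      by (intro sum_mono)
    then show ?thesis by (simp add: F_def sum.distrib)
  qed
  have "m ?r x \<le> m ?r z + m ?q x - m ?q z"
  proof (rule m_leI[OF ne(1)])
    fix t assume t: "t \<in> finite_points x ?r"
    have "m ?q z \<le> m ?r z + m ?q x - F x t"
    proof (rule m_leI[OF ne(2)])
      fix s assume s: "s \<in> finite_points z ?q"
      have "F z t \<le> m ?r z" "F x s \<le> m ?q x" using sub s t by (auto intro!: F_le_m)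
      with exchange[OF t s] show "F z s \<le> m ?r z + m ?q x - F x t" by simp
    qed
    then show "F x t \<le> m ?r z + m ?q x - m ?q z" by simp
  qed
  then show ?thesis by (simp add: D_def)
qed

lemma sum_D: "(\<Sum>k\<in>UNIV. D y $ k) = m (CARD('n)) y - m 0 y"
  unfolding D_def using sum_rank_telescope[of "\<lambda>j. m j y"] by simp

text \<open>All nodes lie right of the first interval. Moving them right enlarges that interval and
  raises each kernel, which decreases on the negative half-line.\<close>

lemma m_first_mono:
  assumes "x \<in> R" "z \<in> R" and le: "\<And>l. x $ l \<le> z $ l"
  shows "m 0 x \<le> m 0 z"
proof (rule m_leI)
  show "finite_points x 0 \<noteq> {}" using assms by (auto simp: R_def)
  fix t assume t: "t \<in> finite_points x 0"
  have t': "t \<in> finite_points z 0" using finite_points_first_mono[OF le] t by blast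
  have "K l (t - x $ l) \<le> K l (t - z $ l)" for l
    using monotone_kernel.decreasing_neg[OF kernels, of "t - z $ l" "t - x $ l" l] le[of l]
      finite_pointsD(3)[OF t, of l] card_atMost_bounds(1)[of l]
    by (cases "x $ l = z $ l") auto
  then have "F x t \<le> F z t" by (auto simp: F_def intro: sum_mono)
  also have "\<dots> \<le> m 0 z" using t' by (rule F_le_m)
  finally show "F x t \<le> m 0 z" .
qed

text \<open>Moving nodes right shrinks the last interval and brings all nodes closer to its points.
  The distances from nodes to near maximizers are at most \<open>2 * T\<close>, a range on which
  every kernel rises at a rate at least \<open>c\<close>.\<close>

lemma m_last_decrease:
  assumes "0 < T"
  obtains c where "0 < c" "\<And>x z. x \<in> R \<Longrightarrow> z \<in> R \<Longrightarrow> (\<And>l. x $ l \<le> z $ l) \<Longrightarrow> (\<And>l. \<bar>x $ l\<bar> \<le> T) \<Longrightarrow>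
    (\<And>t. t \<in> finite_points z (CARD('n)) \<Longrightarrow> m (CARD('n)) z - 1 \<le> F z t \<Longrightarrow> \<bar>t\<bar> \<le> T) \<Longrightarrow>
    c * (\<Sum>l\<in>UNIV. z $ l - x $ l) \<le> m (CARD('n)) x - m (CARD('n)) z"
proof -
  have "\<exists>c>0. \<forall>s t. 0 < s \<longrightarrow> s \<le> t \<longrightarrow> t \<le> 2 * T \<longrightarrow> c * (t - s) \<le> K l t - K l s" for l
    using monotone_kernel.slope_lower_bound[OF kernels, of "2 * T" l] assms by (metis zero_less_mult_iff zero_less_numeral)
  then obtain b where b: "\<And>l. 0 < b l"
      "\<And>l s t. 0 < s \<Longrightarrow> s \<le> t \<Longrightarrow> t \<le> 2 * T \<Longrightarrow> b l * (t - s) \<le> K l t - K l s"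
    by metis
  define c where "c = Min (range b)"
  have c: "0 < c" "\<And>l. c \<le> b l" using b(1) by (auto simp: c_def Min_gr_iff)
  show ?thesis
  proof (rule that[OF c(1)])
    fix x z
    assume R: "x \<in> R" "z \<in> R" and le: "\<And>l. x $ l \<le> z $ l" and xT: "\<And>l. \<bar>x $ l\<bar> \<le> T"
      and near: "\<And>t. t \<in> finite_points z (CARD('n)) \<Longrightarrow> m (CARD('n)) z - 1 \<le> F z t \<Longrightarrow> \<bar>t\<bar> \<le> T"
    have "m (CARD('n)) z \<le> m (CARD('n)) x - c * (\<Sum>l\<in>UNIV. z $ l - x $ l)"
    proof (rule m_le_by_near_maximizers)
      show "finite_points z (CARD('n)) \<noteq> {}" using R(2) by (simp add: R_def)
      fix t assume t: "t \<in> finite_points z (CARD('n))" "m (CARD('n)) z - 1 \<le> F z t"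
      have "c * (z $ l - x $ l) + K l (t - z $ l) \<le> K l (t - x $ l)" for l
      proof -
        have "t - x $ l \<le> 2 * T" using near[OF t] xT[of l] by linarith
        with b(2)[of "t - z $ l" "t - x $ l" l] finite_pointsD(2)[OF t(1), of l] le[of l]
        have "b l * (z $ l - x $ l) \<le> K l (t - x $ l) - K l (t - z $ l)"
          using card_atMost_bounds(2)[of l] by simp
        moreover have "c * (z $ l - x $ l) \<le> b l * (z $ l - x $ l)"
          using c(2) le[of l] by (intro mult_right_mono) auto
        ultimately show ?thesis by simp
      qed
      then have "(\<Sum>l\<in>UNIV. c * (z $ l - x $ l) + K l (t - z $ l)) \<le> (\<Sum>l\<in>UNIV. K l (t - x $ l))"
        by (intro sum_mono)
      then have "F z t \<le> F x t - c * (\<Sum>l\<in>UNIV. z $ l - x $ l)"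
        by (simp add: F_def sum.distrib sum_distrib_left)
      moreover have "F x t \<le> m (CARD('n)) x"
        using finite_points_last_antimono[OF le] t(1) by (intro F_le_m) auto
      ultimately show "F z t \<le> m (CARD('n)) x - c * (\<Sum>l\<in>UNIV. z $ l - x $ l)" by simp
    qed
    then show "c * (\<Sum>l\<in>UNIV. z $ l - x $ l) \<le> m (CARD('n)) x - m (CARD('n)) z" by simp
  qed
qed

section \<open>Coordinatewise maxima and the lower bound for \<open>D\<close>\<close>

definition upper :: "real ^ 'n::{finite,linorder} \<Rightarrow> real ^ 'n::{finite,linorder} \<Rightarrow> real ^ 'n::{finite,linorder}" where
  "upper x y = (\<chi> l. max (x $ l) (y $ l))"

lemma upper_nth [simp]: "upper x y $ l = max (x $ l) (y $ l)"
  by (simp add: upper_def)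

text \<open>At each node the maximum agrees with \<open>x\<close> or with \<open>y\<close>, and the
  interval to its right then contains the corresponding interval of that vector.\<close>

lemma upper_in_R:
  assumes "x \<in> R" "y \<in> R"
  shows "upper x y \<in> R"
  unfolding R_def
proof (intro CollectI allI impI)
  fix j assume j: "j \<le> CARD('n)"
  have mono: "upper x y $ i \<le> upper x y $ k" if "i \<le> k" for i k
    using R_imp_mono[OF assms(1) that] R_imp_mono[OF assms(2) that] by (auto simp: max_def)
  show "finite_points (upper x y) j \<noteq> {}"
  proof (cases "j = 0")
    case True
    have "finite_points x 0 \<subseteq> finite_points (upper x y) 0"
      by (rule finite_points_first_mono) simp
    with True assms show ?thesis by (auto simp: R_def)
  next
    case False
    then obtain k :: 'n where k: "card {..k} = j" using ex_rank[of j] j by auto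
    have "finite_points x j \<subseteq> finite_points (upper x y) j \<or> finite_points y j \<subseteq> finite_points (upper x y) j"
    proof (cases "y $ k \<le> x $ k")
      case True
      have "finite_points x (card {..k}) \<subseteq> finite_points (upper x y) (card {..k})"
        by (rule finite_points_right_of_fixed[OF _ mono]) (use True in auto)
      then show ?thesis by (simp add: k)
    next
      case False
      have "finite_points y (card {..k}) \<subseteq> finite_points (upper x y) (card {..k})"
        by (rule finite_points_right_of_fixed[OF _ mono]) (use False in auto)
      then show ?thesis by (simp add: k)
    qed
    with assms j show ?thesis by (auto simp: R_def)
  qed
qed

text \<open>
  Going from \<open>x\<close> and from \<open>y\<close> up to their maximum decreases the sum of the coordinates of \<open>D\<close> while
  each coordinate belonging to an unmoved node grows.
\<close>

lemma D_lower_bound: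
  assumes R: "x \<in> R" "y \<in> R"
    and x: "c * (\<Sum>l\<in>UNIV. upper x y $ l - x $ l) \<le> m (CARD('n)) x - m (CARD('n)) (upper x y)"
    and y: "c * (\<Sum>l\<in>UNIV. upper x y $ l - y $ l) \<le> m (CARD('n)) y - m (CARD('n)) (upper x y)"
  shows "c * (\<Sum>l\<in>UNIV. \<bar>x $ l - y $ l\<bar>) \<le> (\<Sum>l\<in>UNIV. \<bar>D x $ l - D y $ l\<bar>)"
proof -
  let ?z = "upper x y"
  have z: "?z \<in> R" by (rule upper_in_R[OF R])
  have le: "x $ l \<le> ?z $ l" "y $ l \<le> ?z $ l" for l by auto
  \<comment> \<open>One of the two brackets, that of the vector realizing the maximum at
    \<open>l\<close>, is nonpositive. Reversing its sign increases the sum and yields the difference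
    of the two values of \<open>D\<close>, up to order.\<close>
  have pointwise: "(D x $ l - D ?z $ l) + (D y $ l - D ?z $ l) \<le> \<bar>D x $ l - D y $ l\<bar>" for l
  proof (cases "x $ l \<le> y $ l")
    case True
    have "D y $ l \<le> D ?z $ l"
      by (rule D_mono_at_fixed_node[OF R(2) z le(2)]) (use True in simp)
    then show ?thesis by linarith
  next
    case False
    have "D x $ l \<le> D ?z $ l"
      by (rule D_mono_at_fixed_node[OF R(1) z le(1)]) (use False in simp)
    then show ?thesis by linarith
  qed
  have "\<bar>x $ l - y $ l\<bar> = (?z $ l - x $ l) + (?z $ l - y $ l)" for l
    by (simp add: max_def)
  then have "c * (\<Sum>l\<in>UNIV. \<bar>x $ l - y $ l\<bar>) =
      c * (\<Sum>l\<in>UNIV. ?z $ l - x $ l) + c * (\<Sum>l\<in>UNIV. ?z $ l - y $ l)"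
    by (simp only: sum.distrib distrib_left)
  also have "\<dots> \<le> (m (CARD('n)) x - m (CARD('n)) ?z) + (m (CARD('n)) y - m (CARD('n)) ?z)"
    using x y by (rule add_mono)
  also have "\<dots> \<le> (\<Sum>l\<in>UNIV. (D x $ l - D ?z $ l) + (D y $ l - D ?z $ l))"
    using m_first_mono[OF R(1) z le(1)] m_first_mono[OF R(2) z le(2)]
    by (simp only: sum.distrib sum_subtractf sum_D)
  also have "\<dots> \<le> (\<Sum>l\<in>UNIV. \<bar>D x $ l - D y $ l\<bar>)"
    by (intro sum_mono pointwise)
  finally show ?thesis .
qed

subsection \<open>Local estimates\<close>

text \<open>One point \<open>p j\<close> per interval of \<open>z\<close> survives small
  perturbations of the nodes and stays \<open>\<delta>\<close> away from them. These points serve as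
  test points for \<open>window\<close> and \<open>gap\<close>: since
  \<open>F y (p j) \<le> m j y\<close>, near maximizers lose at most 1 against them.\<close>

lemma near_maximizers_locally_confined:
  assumes z: "z \<in> R"
  obtains \<rho> T where "0 < \<rho>" "0 < T"
    "\<And>y. (\<And>l. \<bar>y $ l - z $ l\<bar> < \<rho>) \<Longrightarrow> y \<in> R"
    "\<And>y l. (\<And>l. \<bar>y $ l - z $ l\<bar> < \<rho>) \<Longrightarrow> \<bar>y $ l\<bar> \<le> T"
    "\<And>y j t. (\<And>l. \<bar>y $ l - z $ l\<bar> < \<rho>) \<Longrightarrow> j \<le> CARD('n) \<Longrightarrow> t \<in> finite_points y j \<Longrightarrow>
      m j y - 1 \<le> F y t \<Longrightarrow> \<bar>t\<bar> \<le> T"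
    "\<And>y j t l. (\<And>l. \<bar>y $ l - z $ l\<bar> < \<rho>) \<Longrightarrow> j \<le> CARD('n) \<Longrightarrow> t \<in> finite_points y j \<Longrightarrow>
      m j y - 1 \<le> F y t \<Longrightarrow> 4 * \<rho> \<le> \<bar>t - y $ l\<bar>"
proof -
  have "\<forall>j\<in>{..CARD('n)}. \<exists>t. t \<in> finite_points z j"
    using z by (auto simp: R_def)
  then obtain p where p: "\<And>j. j \<le> CARD('n) \<Longrightarrow> p j \<in> finite_points z j"
    by (metis atMost_iff)
  define \<delta> where "\<delta> = Min ((\<lambda>(j, l). \<bar>p j - z $ l\<bar> / 2) ` ({..CARD('n)} \<times> UNIV))"
  have \<delta>: "0 < \<delta>"
    unfolding \<delta>_def using finite_pointsD(4)[OF p] by (subst Min_gr_iff) auto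
  have p\<delta>: "2 * \<delta> \<le> \<bar>p j - z $ l\<bar>" if "j \<le> CARD('n)" for j l
  proof -
    have "\<delta> \<le> \<bar>p j - z $ l\<bar> / 2" unfolding \<delta>_def using that by (intro Min_le) auto
    then show ?thesis by simp
  qed
  define P where "P = Max ((\<lambda>j. max \<bar>p j\<bar> \<bar>J (p j)\<bar>) ` {..CARD('n)})"
  have P: "\<bar>p j\<bar> \<le> P" "- P \<le> J (p j)" if "j \<le> CARD('n)" for j
  proof -
    have "max \<bar>p j\<bar> \<bar>J (p j)\<bar> \<le> P" unfolding P_def using that by (intro Max_ge) auto
    then show "\<bar>p j\<bar> \<le> P" "- P \<le> J (p j)" by auto
  qed
  from P(1)[of 0] have "0 \<le> P" by simp
  define Y where "Y = Max (range (\<lambda>l. \<bar>z $ l\<bar>)) + \<delta>"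
  have Y: "\<bar>z $ l\<bar> + \<delta> \<le> Y" for l by (auto simp: Y_def)
  obtain T where T: "0 \<le> T" "\<And>y t0 t. - P \<le> J t0 \<Longrightarrow> \<bar>t0\<bar> \<le> P \<Longrightarrow> (\<And>l. \<delta> \<le> \<bar>t0 - y $ l\<bar>) \<Longrightarrow>
    t \<in> S \<Longrightarrow> (\<And>l. t \<noteq> y $ l) \<Longrightarrow> F y t0 - 1 \<le> F y t \<Longrightarrow> \<bar>t\<bar> \<le> T"
    using window[OF \<delta> \<open>0 \<le> P\<close>] by blast
  obtain \<epsilon> where \<epsilon>: "0 < \<epsilon>" "\<And>y t0 t l. - P \<le> J t0 \<Longrightarrow> \<bar>t0\<bar> \<le> P \<Longrightarrow> (\<And>l. \<delta> \<le> \<bar>t0 - y $ l\<bar>) \<Longrightarrow>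
    (\<And>l. \<bar>y $ l\<bar> \<le> Y) \<Longrightarrow> t \<in> S \<Longrightarrow> (\<And>l. t \<noteq> y $ l) \<Longrightarrow> F y t0 - 1 \<le> F y t \<Longrightarrow> \<epsilon> \<le> \<bar>t - y $ l\<bar>"
    using gap[OF \<delta> \<open>0 \<le> P\<close>] by blast
  \<comment> \<open>Two vectors in the box differ by less than \<open>2 * \<rho>\<close> per
    coordinate. A point \<open>4 * \<rho>\<close> away from the nodes of one is thus
    \<open>2 * \<rho>\<close> away from those of the other, and on the same sides.\<close>
  define \<rho> where "\<rho> = min \<delta> (\<epsilon> / 4)"
  have \<rho>: "0 < \<rho>" "\<rho> \<le> \<delta>" "4 * \<rho> \<le> \<epsilon>" using \<delta> \<epsilon>(1) by (auto simp: \<rho>_def)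
  have py: "p j \<in> finite_points y j" "\<delta> \<le> \<bar>p j - y $ l\<bar>"
    if y: "\<And>l. \<bar>y $ l - z $ l\<bar> < \<rho>" and j: "j \<le> CARD('n)" for y j l
  proof -
    show "\<delta> \<le> \<bar>p j - y $ l\<bar>" using p\<delta>[OF j, of l] y[of l] \<rho>(2) by linarith
    show "p j \<in> finite_points y j"
    proof (rule finite_pointsI)
      show "p j \<in> S" by (rule finite_pointsD(1)[OF p[OF j]])
      show "y $ l < p j" if "card {..l} \<le> j" for l
        using finite_pointsD(2)[OF p[OF j] that] p\<delta>[OF j, of l] y[of l] \<rho> by linarith
      show "p j < y $ l" if "j < card {..l}" for l
        using finite_pointsD(3)[OF p[OF j] that] p\<delta>[OF j, of l] y[of l] \<rho> by linarith
    qed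
  qed
  show ?thesis
  proof (rule that[of \<rho> "max (T + 1) Y"])
    fix y assume y: "\<And>l. \<bar>y $ l - z $ l\<bar> < \<rho>"
    show "y \<in> R" using py[OF y] by (auto simp: R_def)
    have yY: "\<bar>y $ l\<bar> \<le> Y" for l using y[of l] Y[of l] \<rho>(2) by linarith
    then show "\<bar>y $ l\<bar> \<le> max (T + 1) Y" for l by (simp add: max.coboundedI2)
    fix j t assume j: "j \<le> CARD('n)" and t: "t \<in> finite_points y j" "m j y - 1 \<le> F y t"
    have "F y (p j) \<le> m j y" by (rule F_le_m[OF py(1)[OF y j]])
    then have Ft: "F y (p j) - 1 \<le> F y t" using t(2) by simp
    note * = P(2,1)[OF j] py(2)[OF y j]
    have "\<bar>t\<bar> \<le> T" by (rule T(2)[OF * finite_pointsD(1,4)[OF t(1)] Ft])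
    then show "\<bar>t\<bar> \<le> max (T + 1) Y" by simp
    have "\<epsilon> \<le> \<bar>t - y $ l\<bar>" for l
      by (rule \<epsilon>(2)[OF * yY finite_pointsD(1,4)[OF t(1)] Ft])
    then show "4 * \<rho> \<le> \<bar>t - y $ l\<bar>" for l using \<rho>(3) order_trans by blast
  qed (use \<rho>(1) T(1) in auto)
qed

text \<open>For the upper bound, a near maximizer for \<open>y\<close> lies in the same interval of
  \<open>x\<close>, and the kernels are Lipschitz at the distances involved. The factor 2 arises
  because each coordinate of \<open>D\<close> is a difference of two suprema.\<close>

lemma D_locally_bi_Lipschitz_l1:
  assumes z: "z \<in> R"
  obtains \<rho> c L where "0 < \<rho>" "0 < c" "0 \<le> L"
    "\<And>y. (\<And>l. \<bar>y $ l - z $ l\<bar> < \<rho>) \<Longrightarrow> y \<in> R"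
    "\<And>x y. (\<And>l. \<bar>x $ l - z $ l\<bar> < \<rho>) \<Longrightarrow> (\<And>l. \<bar>y $ l - z $ l\<bar> < \<rho>) \<Longrightarrow>
      c * (\<Sum>l\<in>UNIV. \<bar>x $ l - y $ l\<bar>) \<le> (\<Sum>l\<in>UNIV. \<bar>D x $ l - D y $ l\<bar>)"
    "\<And>x y k. (\<And>l. \<bar>x $ l - z $ l\<bar> < \<rho>) \<Longrightarrow> (\<And>l. \<bar>y $ l - z $ l\<bar> < \<rho>) \<Longrightarrow>
      \<bar>D x $ k - D y $ k\<bar> \<le> L * (\<Sum>l\<in>UNIV. \<bar>x $ l - y $ l\<bar>)"
proof -
  obtain \<rho> T where \<rho>: "0 < \<rho>" and T: "0 < T"
    and inR: "\<And>y. (\<And>l. \<bar>y $ l - z $ l\<bar> < \<rho>) \<Longrightarrow> y \<in> R"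
    and bound: "\<And>y l. (\<And>l. \<bar>y $ l - z $ l\<bar> < \<rho>) \<Longrightarrow> \<bar>y $ l\<bar> \<le> T"
    and win: "\<And>y j t. (\<And>l. \<bar>y $ l - z $ l\<bar> < \<rho>) \<Longrightarrow> j \<le> CARD('n) \<Longrightarrow> t \<in> finite_points y j \<Longrightarrow>
      m j y - 1 \<le> F y t \<Longrightarrow> \<bar>t\<bar> \<le> T"
    and away: "\<And>y j t l. (\<And>l. \<bar>y $ l - z $ l\<bar> < \<rho>) \<Longrightarrow> j \<le> CARD('n) \<Longrightarrow> t \<in> finite_points y j \<Longrightarrow>
      m j y - 1 \<le> F y t \<Longrightarrow> 4 * \<rho> \<le> \<bar>t - y $ l\<bar>"
    using near_maximizers_locally_confined[OF z] by blast
  obtain c where c: "0 < c" "\<And>x z. x \<in> R \<Longrightarrow> z \<in> R \<Longrightarrow> (\<And>l. x $ l \<le> z $ l) \<Longrightarrow> (\<And>l. \<bar>x $ l\<bar> \<le> T) \<Longrightarrow>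
    (\<And>t. t \<in> finite_points z (CARD('n)) \<Longrightarrow> m (CARD('n)) z - 1 \<le> F z t \<Longrightarrow> \<bar>t\<bar> \<le> T) \<Longrightarrow>
    c * (\<Sum>l\<in>UNIV. z $ l - x $ l) \<le> m (CARD('n)) x - m (CARD('n)) z"
    using m_last_decrease[OF T] by blast
  have "\<exists>L\<ge>0. \<forall>s t. 2 * \<rho> \<le> \<bar>s\<bar> \<longrightarrow> 2 * \<rho> \<le> \<bar>t\<bar> \<longrightarrow> (0 < s \<longleftrightarrow> 0 < t) \<longrightarrow>
      \<bar>K l t - K l s\<bar> \<le> L * \<bar>t - s\<bar>" for l
    using monotone_kernel.lipschitz_away[OF kernels, of "2 * \<rho>" l] \<rho> by (metis mult_pos_pos zero_less_numeral)
  then obtain q where q: "\<And>l. 0 \<le> q l" "\<And>l s t. 2 * \<rho> \<le> \<bar>s\<bar> \<Longrightarrow> 2 * \<rho> \<le> \<bar>t\<bar> \<Longrightarrow> 0 < s \<longleftrightarrow> 0 < t \<Longrightarrow>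
      \<bar>K l t - K l s\<bar> \<le> q l * \<bar>t - s\<bar>"
    by metis
  define L where "L = (\<Sum>l\<in>UNIV. q l)"
  have L: "0 \<le> L" "q l \<le> L" for l
    unfolding L_def using q(1) by (auto intro: sum_nonneg member_le_sum)
  have m_le: "m j y \<le> m j x + L * (\<Sum>l\<in>UNIV. \<bar>x $ l - y $ l\<bar>)"
    if x: "\<And>l. \<bar>x $ l - z $ l\<bar> < \<rho>" and y: "\<And>l. \<bar>y $ l - z $ l\<bar> < \<rho>" and j: "j \<le> CARD('n)" for x y j
  proof (rule m_le_by_near_maximizers)
    show "finite_points y j \<noteq> {}" using inR[OF y] j by (simp add: R_def)
    fix t assume t: "t \<in> finite_points y j" "m j y - 1 \<le> F y t"
    have ty: "4 * \<rho> \<le> \<bar>t - y $ l\<bar>" for l by (rule away[OF y j t])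
    have xy: "\<bar>x $ l - y $ l\<bar> < 2 * \<rho>" for l using x[of l] y[of l] by linarith
    have "K l (t - y $ l) \<le> K l (t - x $ l) + L * \<bar>x $ l - y $ l\<bar>" for l
    proof -
      have "\<bar>K l (t - y $ l) - K l (t - x $ l)\<bar> \<le> q l * \<bar>(t - y $ l) - (t - x $ l)\<bar>"
        using ty[of l] xy[of l] \<rho> by (intro q(2)) linarith+
      moreover have "q l * \<bar>x $ l - y $ l\<bar> \<le> L * \<bar>x $ l - y $ l\<bar>"
        using L(2) by (intro mult_right_mono) auto
      ultimately show ?thesis by simp
    qed
    then have "(\<Sum>l\<in>UNIV. K l (t - y $ l)) \<le> (\<Sum>l\<in>UNIV. K l (t - x $ l) + L * \<bar>x $ l - y $ l\<bar>)"
      by (intro sum_mono)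
    then have "F y t \<le> F x t + L * (\<Sum>l\<in>UNIV. \<bar>x $ l - y $ l\<bar>)"
      by (simp add: F_def sum.distrib sum_distrib_left)
    moreover have "t \<in> finite_points x j"
    proof (rule finite_pointsI)
      show "t \<in> S" by (rule finite_pointsD(1)[OF t(1)])
      show "x $ l < t" if "card {..l} \<le> j" for l
        using finite_pointsD(2)[OF t(1) that] ty[of l] xy[of l] \<rho> by linarith
      show "t < x $ l" if "j < card {..l}" for l
        using finite_pointsD(3)[OF t(1) that] ty[of l] xy[of l] \<rho> by linarith
    qed
    ultimately show "F y t \<le> m j x + L * (\<Sum>l\<in>UNIV. \<bar>x $ l - y $ l\<bar>)"
      using F_le_m by fastforce
  qed
  show ?thesis
  proof (rule that[of \<rho> c "2 * L"])
    fix x y assume x: "\<And>l. \<bar>x $ l - z $ l\<bar> < \<rho>" and y: "\<And>l. \<bar>y $ l - z $ l\<bar> < \<rho>"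
    \<comment> \<open>A coordinatewise box, unlike a Euclidean ball, is closed under coordinatewise
      maxima.\<close>
    have u: "\<bar>upper x y $ l - z $ l\<bar> < \<rho>" for l
      using x[of l] y[of l] by (auto simp: max_def)
    have le: "x $ l \<le> upper x y $ l" "y $ l \<le> upper x y $ l" for l by auto
    show "c * (\<Sum>l\<in>UNIV. \<bar>x $ l - y $ l\<bar>) \<le> (\<Sum>l\<in>UNIV. \<bar>D x $ l - D y $ l\<bar>)"
      by (rule D_lower_bound[OF inR[OF x] inR[OF y]
          c(2)[OF inR[OF x] inR[OF u] le(1) bound[OF x] win[OF u order_refl]]
          c(2)[OF inR[OF y] inR[OF u] le(2) bound[OF y] win[OF u order_refl]]])
    fix k :: 'n
    have k: "card {..k} \<le> CARD('n)" "card {..<k} \<le> CARD('n)"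
      using card_atMost_bounds(2)[of k] by (auto simp: card_lessThan_eq)
    show "\<bar>D x $ k - D y $ k\<bar> \<le> 2 * L * (\<Sum>l\<in>UNIV. \<bar>x $ l - y $ l\<bar>)"
      using m_le[OF x y k(1)] m_le[OF x y k(2)] m_le[OF y x k(1)] m_le[OF y x k(2)]
      by (simp add: D_def abs_minus_commute[of "y $ _"])
  qed (use \<rho> c(1) L(1) inR in auto)
qed

lemma D_locally_bi_Lipschitz:
  assumes z: "z \<in> R"
  shows "\<exists>U c C. open U \<and> z \<in> U \<and> U \<subseteq> R \<and> 0 < c \<and> c \<le> C \<and>
    (\<forall>x\<in>U. \<forall>y\<in>U. c * norm (x - y) \<le> norm (D x - D y) \<and> norm (D x - D y) \<le> C * norm (x - y))"
proof -
  obtain \<rho> c L where \<rho>: "0 < \<rho>" and c: "0 < c" and L: "0 \<le> L"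
    and inR: "\<And>y. (\<And>l. \<bar>y $ l - z $ l\<bar> < \<rho>) \<Longrightarrow> y \<in> R"
    and low: "\<And>x y. (\<And>l. \<bar>x $ l - z $ l\<bar> < \<rho>) \<Longrightarrow> (\<And>l. \<bar>y $ l - z $ l\<bar> < \<rho>) \<Longrightarrow>
      c * (\<Sum>l\<in>UNIV. \<bar>x $ l - y $ l\<bar>) \<le> (\<Sum>l\<in>UNIV. \<bar>D x $ l - D y $ l\<bar>)"
    and up: "\<And>x y k. (\<And>l. \<bar>x $ l - z $ l\<bar> < \<rho>) \<Longrightarrow> (\<And>l. \<bar>y $ l - z $ l\<bar> < \<rho>) \<Longrightarrow>
      \<bar>D x $ k - D y $ k\<bar> \<le> L * (\<Sum>l\<in>UNIV. \<bar>x $ l - y $ l\<bar>)"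
    using D_locally_bi_Lipschitz_l1[OF z] by blast
  let ?n = "real CARD('n)"
  have n: "0 < ?n" by simp
  have near: "\<bar>x $ l - z $ l\<bar> < \<rho>" if "x \<in> ball z \<rho>" for x l
    using component_le_norm_cart[of "x - z" l] that by (simp add: dist_norm norm_minus_commute)
  have l1: "(\<Sum>l\<in>UNIV. \<bar>v $ l\<bar>) \<le> ?n * norm v" for v :: "real ^ 'n::{finite,linorder}"
    using sum_bounded_above[of UNIV "\<lambda>l. \<bar>v $ l\<bar>" "norm v"] component_le_norm_cart[of v] by simp
  show ?thesis
  \<comment> \<open>The factors \<open>?n\<close> come from comparing the sum norm with the
    Euclidean norm; the maximum ensures that the first constant is at most the second.\<close>
  proof (rule exI[of _ "ball z \<rho>"], rule exI[of _ "c / ?n"],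
      rule exI[of _ "max (c / ?n) (?n * (L * ?n))"], intro conjI ballI)
    show "ball z \<rho> \<subseteq> R" using near inR by blast
    fix x y assume "x \<in> ball z \<rho>" "y \<in> ball z \<rho>"
    then have x: "\<And>l. \<bar>x $ l - z $ l\<bar> < \<rho>" and y: "\<And>l. \<bar>y $ l - z $ l\<bar> < \<rho>" using near by auto
    have "c * norm (x - y) \<le> c * (\<Sum>l\<in>UNIV. \<bar>x $ l - y $ l\<bar>)"
      using norm_le_l1_cart[of "x - y"] c by (intro mult_left_mono) auto
    also have "\<dots> \<le> ?n * norm (D x - D y)"
      using low[OF x y] l1[of "D x - D y"] by simp
    finally show "c / ?n * norm (x - y) \<le> norm (D x - D y)"
      using n by (simp add: field_simps)
    have "norm (D x - D y) \<le> (\<Sum>k\<in>UNIV. \<bar>D x $ k - D y $ k\<bar>)"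
      using norm_le_l1_cart[of "D x - D y"] by simp
    also have "\<dots> \<le> ?n * (L * (\<Sum>l\<in>UNIV. \<bar>x $ l - y $ l\<bar>))"
      using sum_bounded_above[of UNIV "\<lambda>k. \<bar>D x $ k - D y $ k\<bar>"] up[OF x y] by simp
    also have "\<dots> \<le> ?n * (L * (?n * norm (x - y)))"
      using l1[of "x - y"] L by (intro mult_left_mono) auto
    also have "\<dots> \<le> max (c / ?n) (?n * (L * ?n)) * norm (x - y)"
      by (simp add: mult.assoc[symmetric] mult_right_mono)
    finally show "norm (D x - D y) \<le> max (c / ?n) (?n * (L * ?n)) * norm (x - y)" .
  qed (use \<rho> c n in auto)
qed

lemma open_R: "open R"
proof (subst open_subopen, intro ballI)
  fix z assume "z \<in> R"
  from D_locally_bi_Lipschitz[OF this] show "\<exists>U. open U \<and> z \<in> U \<and> U \<subseteq> R"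
    by (elim exE conjE) (intro exI conjI)
qed

lemma continuous_on_D: "continuous_on R D"
proof -
  have "isCont D z" if z: "z \<in> R" for z
  proof -
    obtain U c C where U: "open U" "z \<in> U" "0 < c" "c \<le> C"
      "\<forall>x\<in>U. \<forall>y\<in>U. c * norm (x - y) \<le> norm (D x - D y) \<and> norm (D x - D y) \<le> C * norm (x - y)"
      using D_locally_bi_Lipschitz[OF z] by (elim exE conjE) (rule that; assumption)
    have "C-lipschitz_on U D"
      using U by (intro lipschitz_onI) (auto simp: dist_norm)
    then have "continuous_on U D" by (rule lipschitz_on_continuous_on)
    with U show ?thesis by (simp add: continuous_on_eq_continuous_at)
  qed
  then show ?thesis by (simp add: continuous_at_imp_continuous_on)
qed

text \<open>\<open>D_lower_bound\<close> does not require \<open>x\<close> and \<open>y\<close> to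
  be close: a constant \<open>c\<close> depending on the pair suffices. So \<open>T'\<close> only
  has to cover both vectors and the near maximizers of their maximum.\<close>

lemma inj_on_D: "inj_on D R"
proof (rule inj_onI)
  fix x y assume R: "x \<in> R" "y \<in> R" and eq: "D x = D y"
  have z: "upper x y \<in> R" by (rule upper_in_R[OF R])
  obtain \<rho> T where \<rho>: "0 < \<rho>" and T: "0 < T"
    and "\<And>w. (\<And>l. \<bar>w $ l - upper x y $ l\<bar> < \<rho>) \<Longrightarrow> w \<in> R"
    and "\<And>w l. (\<And>l. \<bar>w $ l - upper x y $ l\<bar> < \<rho>) \<Longrightarrow> \<bar>w $ l\<bar> \<le> T"
    and near: "\<And>w j t. (\<And>l. \<bar>w $ l - upper x y $ l\<bar> < \<rho>) \<Longrightarrow> j \<le> CARD('n) \<Longrightarrow>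
      t \<in> finite_points w j \<Longrightarrow> m j w - 1 \<le> F w t \<Longrightarrow> \<bar>t\<bar> \<le> T"
    and "\<And>w j t l. (\<And>l. \<bar>w $ l - upper x y $ l\<bar> < \<rho>) \<Longrightarrow> j \<le> CARD('n) \<Longrightarrow>
      t \<in> finite_points w j \<Longrightarrow> m j w - 1 \<le> F w t \<Longrightarrow> 4 * \<rho> \<le> \<bar>t - w $ l\<bar>"
    using near_maximizers_locally_confined[OF z] by blast
  define T' where "T' = T + (\<Sum>l\<in>UNIV. \<bar>x $ l\<bar>) + (\<Sum>l\<in>UNIV. \<bar>y $ l\<bar>)"
  have s0: "0 \<le> (\<Sum>l\<in>UNIV. \<bar>x $ l\<bar>)" "0 \<le> (\<Sum>l\<in>UNIV. \<bar>y $ l\<bar>)" by (auto intro: sum_nonneg)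
  have "0 < T'" using T s0 unfolding T'_def by linarith
  then obtain c where c: "0 < c"
    "\<And>x z. x \<in> R \<Longrightarrow> z \<in> R \<Longrightarrow> (\<And>l. x $ l \<le> z $ l) \<Longrightarrow> (\<And>l. \<bar>x $ l\<bar> \<le> T') \<Longrightarrow>
    (\<And>t. t \<in> finite_points z (CARD('n)) \<Longrightarrow> m (CARD('n)) z - 1 \<le> F z t \<Longrightarrow> \<bar>t\<bar> \<le> T') \<Longrightarrow>
    c * (\<Sum>l\<in>UNIV. z $ l - x $ l) \<le> m (CARD('n)) x - m (CARD('n)) z"
    using m_last_decrease by blast
  have xT: "\<bar>x $ l\<bar> \<le> T'" and yT: "\<bar>y $ l\<bar> \<le> T'" for l
    using member_le_sum[of l UNIV "\<lambda>l. \<bar>x $ l\<bar>"] member_le_sum[of l UNIV "\<lambda>l. \<bar>y $ l\<bar>"] T s0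
    unfolding T'_def by simp_all
  have win: "\<bar>t\<bar> \<le> T'" if "t \<in> finite_points (upper x y) (CARD('n))"
      "m (CARD('n)) (upper x y) - 1 \<le> F (upper x y) t" for t
  proof -
    have "\<bar>t\<bar> \<le> T" using \<rho> by (intro near[OF _ order_refl that]) simp
    then show ?thesis using s0 unfolding T'_def by linarith
  qed
  have le: "x $ l \<le> upper x y $ l" "y $ l \<le> upper x y $ l" for l by auto
  have "c * (\<Sum>l\<in>UNIV. \<bar>x $ l - y $ l\<bar>) \<le> (\<Sum>l\<in>UNIV. \<bar>D x $ l - D y $ l\<bar>)"
    by (rule D_lower_bound[OF R c(2)[OF R(1) z le(1) xT win] c(2)[OF R(2) z le(2) yT win]])
  then have "c * (\<Sum>l\<in>UNIV. \<bar>x $ l - y $ l\<bar>) \<le> 0" by (simp add: eq)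
  then have "(\<Sum>l\<in>UNIV. \<bar>x $ l - y $ l\<bar>) \<le> 0" using c(1) by (simp add: mult_le_0_iff)
  moreover have "0 \<le> (\<Sum>l\<in>UNIV. \<bar>x $ l - y $ l\<bar>)" by (intro sum_nonneg) auto
  ultimately have "(\<Sum>l\<in>UNIV. \<bar>x $ l - y $ l\<bar>) = 0" by simp
  then have "\<forall>l\<in>UNIV. \<bar>x $ l - y $ l\<bar> = 0" by (subst (asm) sum_nonneg_eq_0_iff) auto
  then show "x = y" by (simp add: vec_eq_iff)
qed

subsection \<open>Surjectivity\<close>

lemma ex_finite_subset:
  obtains A where "A \<subseteq> S" "finite A" "card A = CARD('n) + 1"
proof (cases "finite S")
  case True
  with many_points have "CARD('n) + 1 \<le> card S" by simp
  then show ?thesis using obtain_subset_with_card_n that by metis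
next
  case False
  then show ?thesis using infinite_arbitrarily_large[of S "CARD('n) + 1"] that by metis
qed

text \<open>
  Any \<open>n + 1\<close> points of \<open>S\<close> serve as test points: one of them is bounded away from all \<open>n\<close> nodes.
\<close>

lemma test_points:
  obtains \<delta> P where "0 < \<delta>" "0 \<le> P"
    "\<And>y :: real ^ 'n::{finite,linorder}. \<exists>t\<in>S. \<bar>t\<bar> \<le> P \<and> - P \<le> J t \<and> (\<forall>l. \<delta> \<le> \<bar>t - y $ l\<bar>)"
proof -
  obtain A where A: "A \<subseteq> S" "finite A" "card A = CARD('n) + 1"
    by (rule ex_finite_subset)
  define E where "E = (\<lambda>(s, t). \<bar>s - t\<bar> / 2) ` {p \<in> A \<times> A. fst p \<noteq> snd p}"
  define \<delta> where "\<delta> = Min (insert 1 E)"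
  have E: "finite E" using A(2) by (simp add: E_def)
  have \<delta>: "0 < \<delta>" unfolding \<delta>_def using E by (subst Min_gr_iff) (auto simp: E_def)
  have sep: "2 * \<delta> \<le> \<bar>s - t\<bar>" if "s \<in> A" "t \<in> A" "s \<noteq> t" for s t
  proof -
    have "\<bar>s - t\<bar> / 2 \<in> E" using that by (force simp: E_def)
    then have "\<delta> \<le> \<bar>s - t\<bar> / 2" unfolding \<delta>_def using E by (intro Min_le) auto
    then show ?thesis by simp
  qed
  define P where "P = (\<Sum>t\<in>A. \<bar>t\<bar> + \<bar>J t\<bar>)"
  have P: "\<bar>t\<bar> + \<bar>J t\<bar> \<le> P" if "t \<in> A" for t
    unfolding P_def using A(2) that by (intro member_le_sum) auto
  show ?thesis
  proof (rule that[OF \<delta>])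
    show "0 \<le> P" unfolding P_def by (intro sum_nonneg) auto
    fix y :: "real ^ 'n::{finite,linorder}"
    have "\<exists>t\<in>A. \<forall>l. \<delta> \<le> \<bar>t - y $ l\<bar>"
    proof (rule ccontr)
      assume "\<not> ?thesis"
      then obtain g where g: "\<And>t. t \<in> A \<Longrightarrow> \<bar>t - y $ g t\<bar> < \<delta>"
        by (metis not_less)
      have "inj_on g A"
      \<comment> \<open>Two points sharing a node within \<open>\<delta>\<close> would be less than
        \<open>2 * \<delta>\<close> apart. So the \<open>n + 1\<close> points would need distinct
        nodes.\<close>
      proof (rule inj_onI, rule ccontr)
        fix s t assume st: "s \<in> A" "t \<in> A" "g s = g t" "s \<noteq> t"
        show False using sep[OF st(1,2,4)] g[OF st(1)] g[OF st(2)] unfolding st(3) by linarith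
      qed
      then have "card A \<le> CARD('n)" by (intro card_inj_on_le[where f = g]) auto
      with A(3) show False by simp
    qed
    then obtain t where t: "t \<in> A" "\<And>l. \<delta> \<le> \<bar>t - y $ l\<bar>" by blast
    have "\<bar>t\<bar> \<le> P" "- P \<le> J t" using P[OF t(1)] by linarith+
    with t A(1) show "\<exists>t\<in>S. \<bar>t\<bar> \<le> P \<and> - P \<le> J t \<and> (\<forall>l. \<delta> \<le> \<bar>t - y $ l\<bar>)"
      by blast
  qed
qed

lemma m_diff_bound:
  assumes "\<And>k. \<bar>D y $ k\<bar> \<le> C" "j \<le> CARD('n)"
  shows "\<bar>m j y - m 0 y\<bar> \<le> real j * C"
  using assms(2)
proof (induction j)
  case (Suc j)
  obtain k :: 'n where k: "card {..k} = Suc j" using ex_rank[of "Suc j"] Suc.prems by auto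
  then have "D y $ k = m (Suc j) y - m j y" by (simp add: D_def card_lessThan_eq)
  with assms(1)[of k] Suc show ?case by (simp add: distrib_right)
qed simp

text \<open>Bounded differences keep all suprema within a fixed distance of each other. As a test
  point lies in some interval, every interval contains a point that loses at most \<open>B\<close>
  against it. \<open>window\<close> bounds these points and thereby the nodes, after which
  \<open>gap\<close> keeps them away from the nodes.\<close>

lemma preimage_of_bounded:
  "\<exists>T. \<exists>\<epsilon>>0. \<forall>y\<in>R. (\<forall>k. \<bar>D y $ k\<bar> \<le> C) \<longrightarrow>
    (\<forall>l. \<bar>y $ l\<bar> \<le> T) \<and> (\<forall>j\<le>CARD('n). \<exists>t\<in>finite_points y j. \<forall>l. \<epsilon> \<le> \<bar>t - y $ l\<bar>)"
proof -
  \<comment> \<open>Each supremum is within \<open>n * \<bar>C\<bar>\<close> of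
    \<open>m 0 y\<close>, which is used for two intervals; a near maximizer may lose another
    1.\<close>
  define B where "B = 2 * (real CARD('n) * \<bar>C\<bar>) + 1"
  obtain \<delta> P where \<delta>: "0 < \<delta>" and P: "0 \<le> P"
    and test: "\<And>y :: real ^ 'n::{finite,linorder}. \<exists>t\<in>S. \<bar>t\<bar> \<le> P \<and> - P \<le> J t \<and> (\<forall>l. \<delta> \<le> \<bar>t - y $ l\<bar>)"
    by (rule test_points) blast
  obtain T where T: "\<And>y t0 t. - P \<le> J t0 \<Longrightarrow> \<bar>t0\<bar> \<le> P \<Longrightarrow> (\<And>l. \<delta> \<le> \<bar>t0 - y $ l\<bar>) \<Longrightarrow>
    t \<in> S \<Longrightarrow> (\<And>l. t \<noteq> y $ l) \<Longrightarrow> F y t0 - B \<le> F y t \<Longrightarrow> \<bar>t\<bar> \<le> T"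
    by (rule window[OF \<delta> P]) blast
  obtain \<epsilon> where \<epsilon>: "0 < \<epsilon>" "\<And>y t0 t l. - P \<le> J t0 \<Longrightarrow> \<bar>t0\<bar> \<le> P \<Longrightarrow> (\<And>l. \<delta> \<le> \<bar>t0 - y $ l\<bar>) \<Longrightarrow>
    (\<And>l. \<bar>y $ l\<bar> \<le> T) \<Longrightarrow> t \<in> S \<Longrightarrow> (\<And>l. t \<noteq> y $ l) \<Longrightarrow> F y t0 - B \<le> F y t \<Longrightarrow> \<epsilon> \<le> \<bar>t - y $ l\<bar>"
    by (rule gap[OF \<delta> P]) blast
  have main: "(\<forall>l. \<bar>y $ l\<bar> \<le> T) \<and> (\<forall>j\<le>CARD('n). \<exists>t\<in>finite_points y j. \<forall>l. \<epsilon> \<le> \<bar>t - y $ l\<bar>)"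
    if y: "y \<in> R" "\<And>k. \<bar>D y $ k\<bar> \<le> C" for y
  proof -
    obtain t0 where t0: "t0 \<in> S" "\<bar>t0\<bar> \<le> P" "- P \<le> J t0" "\<And>l. \<delta> \<le> \<bar>t0 - y $ l\<bar>"
      using test[of y] by blast
    have "t0 \<noteq> y $ l" for l using t0(4)[of l] \<delta> by auto
    with mono_imp_finite_points[OF R_imp_mono[OF y(1)] t0(1)]
    obtain i where i: "i \<le> CARD('n)" "t0 \<in> finite_points y i" by blast
    have "\<exists>t. t \<in> finite_points y j \<and> F y t0 - B \<le> F y t" if j: "j \<le> CARD('n)" for j
    proof -
      have "\<bar>m k y - m 0 y\<bar> \<le> real CARD('n) * \<bar>C\<bar>" if "k \<le> CARD('n)" for k
      proof -
        have "\<bar>m k y - m 0 y\<bar> \<le> real k * \<bar>C\<bar>"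
          using y(2) by (intro m_diff_bound that) (meson abs_ge_self order_trans)
        also have "\<dots> \<le> real CARD('n) * \<bar>C\<bar>" using that by (intro mult_right_mono) auto
        finally show ?thesis .
      qed
      from this[OF i(1)] this[OF j] have "m i y - B + 1 \<le> m j y" by (simp add: B_def)
      moreover have "F y t0 \<le> m i y" by (rule F_le_m[OF i(2)])
      moreover have "finite_points y j \<noteq> {}" using y(1) j by (simp add: R_def)
      then obtain t where "t \<in> finite_points y j" "m j y - 1 < F y t"
        using near_maximizer[of y j 1] by auto
      ultimately show ?thesis by (intro exI[of _ t]) simp
    qed
    then obtain q where q: "\<And>j. j \<le> CARD('n) \<Longrightarrow> q j \<in> finite_points y j"
      "\<And>j. j \<le> CARD('n) \<Longrightarrow> F y t0 - B \<le> F y (q j)" by metis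
    have qT: "\<bar>q j\<bar> \<le> T" if "j \<le> CARD('n)" for j
      by (rule T[OF t0(3,2,4) finite_pointsD(1,4)[OF q(1)[OF that]] q(2)[OF that]])
    \<comment> \<open>All nodes lie between the points \<open>q 0\<close> and
      \<open>q (CARD('n))\<close> of the two unbounded intervals.\<close>
    have yT: "\<bar>y $ l\<bar> \<le> T" for l
      using qT[of 0] qT[of "CARD('n)"] finite_pointsD(3)[OF q(1)[of 0], of l]
        finite_pointsD(2)[OF q(1)[of "CARD('n)"], of l] card_atMost_bounds[of l] by simp
    have "\<epsilon> \<le> \<bar>q j - y $ l\<bar>" if "j \<le> CARD('n)" for j l
      by (rule \<epsilon>(2)[OF t0(3,2,4) yT finite_pointsD(1,4)[OF q(1)[OF that]] q(2)[OF that]])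
    with yT q(1) show ?thesis by blast
  qed
  show ?thesis
  proof (rule exI[of _ T], rule exI[of _ \<epsilon>], intro conjI[OF \<epsilon>(1)] ballI impI)
    fix y assume "y \<in> R" "\<forall>k. \<bar>D y $ k\<bar> \<le> C"
    then show "(\<forall>l. \<bar>y $ l\<bar> \<le> T) \<and> (\<forall>j\<le>CARD('n). \<exists>t\<in>finite_points y j. \<forall>l. \<epsilon> \<le> \<bar>t - y $ l\<bar>)"
      by (intro main) auto
  qed
qed

text \<open>Nodes halfway between consecutive members of \<open>n + 1\<close> points of
  \<open>S\<close> leave one of these points in each interval. With lists starting at 0, the point
  \<open>xs ! j\<close> belongs to interval \<open>j\<close>.\<close>

lemma R_nonempty: "R \<noteq> {}"
proof -
  obtain A where A: "A \<subseteq> S" "finite A" "card A = CARD('n) + 1"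
    by (rule ex_finite_subset)
  define xs where "xs = sorted_list_of_set A"
  have xs: "length xs = CARD('n) + 1" "set xs = A" "sorted_wrt (<) xs"
    using A by (auto simp: xs_def)
  have less: "xs ! i < xs ! j" if "i < j" "j \<le> CARD('n)" for i j
    using sorted_wrt_nth_less[OF xs(3) that(1)] that(2) xs(1) by simp
  then have le: "xs ! i \<le> xs ! j" if "i \<le> j" "j \<le> CARD('n)" for i j
    using that by (cases "i = j") (auto simp: order.order_iff_strict)
  define y :: "real ^ 'n::{finite,linorder}" where
    "y = (\<chi> l. (xs ! (card {..l} - 1) + xs ! card {..l}) / 2)"
  have "xs ! j \<in> finite_points y j" if j: "j \<le> CARD('n)" for j
  proof (rule finite_pointsI)
    show "xs ! j \<in> S" using A(1) xs(1,2) j nth_mem[of j xs] by auto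
    show "y $ l < xs ! j" if "card {..l} \<le> j" for l
      using less[of "card {..l} - 1" "card {..l}"] le[OF that j] card_atMost_bounds[of l]
      by (simp add: y_def)
    show "xs ! j < y $ l" if "j < card {..l}" for l
    proof -
      have "xs ! (card {..l} - 1) < xs ! card {..l}" "xs ! j \<le> xs ! (card {..l} - 1)"
        using that card_atMost_bounds[of l] by (auto intro!: less le)
      then show ?thesis by (simp add: y_def)
    qed
  qed
  then have "y \<in> R" by (auto simp: R_def)
  then show ?thesis by blast
qed

text \<open>Preimages of a convergent sequence are bounded, so a subsequence converges. Its limit
  stays in \<open>R\<close>: a single member within \<open>\<epsilon>\<close> of the limit provides
  points that remain strictly inside the intervals.\<close>

lemma closed_D_image: "closed (D ` R)"
proof (rule closed_sequential_limits[THEN iffD2], intro allI impI)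
  fix v d assume vd: "(\<forall>i. v i \<in> D ` R) \<and> v \<longlonglongrightarrow> d"
  then have v: "\<And>i. v i \<in> D ` R" and lim: "v \<longlonglongrightarrow> d" by auto
  have "\<exists>w. w \<in> R \<and> v i = D w" for i using v[of i] by blast
  then obtain y where y: "\<And>i. y i \<in> R" "\<And>i. v i = D (y i)"
    by metis
  have "Bseq v" using lim convergentI convergent_imp_Bseq by blast
  then obtain C where "\<And>i. norm (v i) \<le> C" by (auto simp: Bseq_def)
  then have C: "\<bar>D (y i) $ k\<bar> \<le> C" for i k
    using component_le_norm_cart[of "D (y i)" k] y(2)[of i] by (metis order_trans)
  obtain T \<epsilon> where \<epsilon>: "0 < \<epsilon>" and T: "\<And>i l. \<bar>y i $ l\<bar> \<le> T"
    and away: "\<And>i j. j \<le> CARD('n) \<Longrightarrow> \<exists>t\<in>finite_points (y i) j. \<forall>l. \<epsilon> \<le> \<bar>t - y i $ l\<bar>"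
    using preimage_of_bounded[of C] y(1) C by metis
  have "norm (y i) \<le> real CARD('n) * T" for i
    using norm_le_l1_cart[of "y i"] sum_bounded_above[of UNIV "\<lambda>l. \<bar>y i $ l\<bar>" T] T
    by fastforce
  then have "bounded (range y)" by (auto simp: bounded_iff)
  then obtain w r where r: "strict_mono r" and w: "(y \<circ> r) \<longlonglongrightarrow> w"
    using bounded_imp_convergent_subsequence by blast
  from w \<epsilon> obtain i where i: "dist ((y \<circ> r) i) w < \<epsilon>"
    using LIMSEQ_D[of "y \<circ> r" w \<epsilon>] by (metis dist_norm order_refl)
  have near: "\<bar>y (r i) $ l - w $ l\<bar> < \<epsilon>" for l
    using component_le_norm_cart[of "y (r i) - w" l] i by (simp add: dist_norm)
  have "w \<in> R"
    unfolding R_def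
  proof (intro CollectI allI impI)
    fix j assume j: "j \<le> CARD('n)"
    obtain t where t: "t \<in> finite_points (y (r i)) j" "\<And>l. \<epsilon> \<le> \<bar>t - y (r i) $ l\<bar>"
      using away[OF j, of "r i"] by blast
    have "t \<in> finite_points w j"
    proof (rule finite_pointsI)
      show "t \<in> S" by (rule finite_pointsD(1)[OF t(1)])
      show "w $ l < t" if "card {..l} \<le> j" for l
        using finite_pointsD(2)[OF t(1) that] t(2)[of l] near[of l] by linarith
      show "t < w $ l" if "j < card {..l}" for l
        using finite_pointsD(3)[OF t(1) that] t(2)[of l] near[of l] by linarith
    qed
    then show "finite_points w j \<noteq> {}" by blast
  qed
  have "(\<lambda>i. D ((y \<circ> r) i)) \<longlonglongrightarrow> D w"
    using continuous_on_D w \<open>w \<in> R\<close> y(1)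
    by (intro continuous_on_tendsto_compose[OF continuous_on_D w]) auto
  moreover have "(\<lambda>i. D ((y \<circ> r) i)) = v \<circ> r" by (auto simp: y(2))
  moreover have "(v \<circ> r) \<longlonglongrightarrow> d" using lim r by (rule LIMSEQ_subseq_LIMSEQ)
  ultimately have "d = D w" using LIMSEQ_unique by metis
  with \<open>w \<in> R\<close> show "d \<in> D ` R" by blast
qed

lemma D_homeomorphism: "\<exists>g. homeomorphism R UNIV D g"
proof -
  have "open (D ` R)"
    by (rule invariance_of_domain[OF continuous_on_D open_R inj_on_D])
  with closed_D_image R_nonempty have "D ` R = UNIV"
    using clopen[of "D ` R"] by blast
  moreover obtain g where "homeomorphism R (D ` R) D g"
    by (rule invariance_of_domain_homeomorphism[OF open_R continuous_on_D _ inj_on_D]) auto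
  ultimately show ?thesis by auto
qed

lemma D_locally_bi_Lipschitz_on: "locally_bi_Lipschitz_on R D"
  unfolding locally_bi_Lipschitz_on_def
proof
  fix z assume "z \<in> R"
  obtain U c C where U: "open U" "z \<in> U" "U \<subseteq> R" "0 < c" "c \<le> C"
    "\<forall>x\<in>U. \<forall>y\<in>U. c * norm (x - y) \<le> norm (D x - D y) \<and> norm (D x - D y) \<le> C * norm (x - y)"
    using D_locally_bi_Lipschitz[OF \<open>z \<in> R\<close>] by (elim exE conjE) (rule that; assumption)
  have "openin (top_of_set R) U" using U(1,3) by (simp add: openin_open_eq open_R)
  with U show "\<exists>U c C. openin (top_of_set R) U \<and> z \<in> U \<and> 0 < c \<and> c \<le> C \<and>
      (\<forall>x\<in>U. \<forall>y\<in>U. c * norm (x - y) \<le> norm (D x - D y) \<and> norm (D x - D y) \<le> C * norm (x - y))"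
    by blast
qed

end

section \<open>Normalization of the kernels\<close>

lemma strictly_concave_on_slopes:
  fixes f :: "real \<Rightarrow> real"
  assumes "strictly_concave_on S f" "p \<in> S" "r \<in> S" "p < q" "q < r"
  shows "(f r - f q) * (q - p) < (f q - f p) * (r - q)"
proof -
  define u v where "u = (r - q) / (r - p)" "v = (q - p) / (r - p)"
  have "u *\<^sub>R p + v *\<^sub>R r = ((r - q) * p + (q - p) * r) / (r - p)"
    by (simp add: u_v_def add_divide_distrib)
  also have "(r - q) * p + (q - p) * r = q * (r - p)"
    by (simp add: algebra_simps)
  finally have eq: "u *\<^sub>R p + v *\<^sub>R r = q"
    using assms(4,5) by simp
  have uv: "0 < u" "0 < v" "u + v = 1"
    using assms(4,5) by (auto simp: u_v_def simp flip: add_divide_distrib)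
  have "u * f p + v * f r < f q"
    using assms uv unfolding strictly_concave_on_def eq[symmetric]
    by (metis less_irrefl order.strict_trans)
  then have "(u * f p + v * f r) * (r - p) < f q * (r - p)"
    using assms(4,5) by simp
  also have "(u * f p + v * f r) * (r - p) = (u * (r - p)) * f p + (v * (r - p)) * f r"
    by (simp add: algebra_simps)
  also have "u * (r - p) = r - q"
    using assms(4,5) by (simp add: u_v_def)
  also have "v * (r - p) = q - p"
    using assms(4,5) by (simp add: u_v_def)
  finally have "(r - q) * f p + (q - p) * f r < f q * (r - p)" .
  then show ?thesis by (simp add: algebra_simps)
qed

section \<open>Tangents and limits of the derivative\<close>

lemma concave_on_below_tangent:
  fixes f :: "real \<Rightarrow> real"
  assumes "concave_on S f" "open S" "connected S" "w \<in> S" "x \<in> S" "f differentiable (at w)"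
  shows "f x - f w \<le> deriv f w * (x - w)"
proof -
  have "(f has_real_derivative deriv f w) (at w)"
    using assms(6) DERIV_deriv_iff_real_differentiable by blast
  then have "((\<lambda>x. - f x) has_real_derivative - deriv f w) (at w within S)"
    by (auto intro: derivative_intros has_field_derivative_at_within)
  moreover have "convex_on S (\<lambda>x. - f x)" using assms(1) by (simp add: concave_on_def)
  ultimately have "- deriv f w * (x - w) \<le> - f x - - f w"
    using assms by (intro convex_on_imp_above_tangent[where A = S]) (auto simp: interior_open)
  then show ?thesis by simp
qed

lemma concave_on_deriv_antimono:
  fixes f :: "real \<Rightarrow> real"
  assumes "concave_on S f" "open S" "connected S" "s \<in> S" "t \<in> S" "s \<le> t"
    "f differentiable (at s)" "f differentiable (at t)"
  shows "deriv f t \<le> deriv f s"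
proof (cases "s = t")
  case False
  have "f t - f s \<le> deriv f s * (t - s)" "f s - f t \<le> deriv f t * (s - t)"
    using assms by (auto intro!: concave_on_below_tangent[of S f])
  then have "deriv f t * (t - s) \<le> deriv f s * (t - s)" by (simp add: algebra_simps)
  with False assms(6) show ?thesis by simp
qed simp

lemma concave_on_subset: "concave_on S f \<Longrightarrow> T \<subseteq> S \<Longrightarrow> convex T \<Longrightarrow> concave_on T f"
  unfolding concave_on_def by (rule convex_on_subset)

text \<open>\<open>Lim\<close> carries its intended meaning only along a nontrivial filter and for
  an existing limit. Differentiability points in every interval give the former, antitonicity of the
  derivative the latter.\<close>

lemma deriv_limit_at_bot:
  fixes K :: "real \<Rightarrow> real"
  assumes K: "concave_on {..<0} K"
  shows "deriv_limit at_bot K = (SUP s\<in>{s. s < 0 \<and> K differentiable (at s)}. ereal (deriv K s))"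
    (is "_ = Sup (_ ` ?A)")
  unfolding deriv_limit_def
proof (rule tendsto_Lim)
  have anti: "deriv K t \<le> deriv K s" if "s \<in> ?A" "t \<in> ?A" "s \<le> t" for s t
    by (rule concave_on_deriv_antimono[OF K]) (use that in auto)
  show "\<not> trivial_limit (inf at_bot (principal {t. K differentiable (at t)}))"
  proof
    assume "trivial_limit (inf at_bot (principal {t. K differentiable (at t)}))"
    then obtain N where N: "\<And>t. t \<le> N \<Longrightarrow> \<not> K differentiable (at t)"
      by (auto simp: trivial_limit_def eventually_inf_principal eventually_at_bot_linorder)
    have conc: "concave_on {min N 0 - 1<..<min N 0} K"
      using K by (rule concave_on_subset) auto
    have "min N 0 - 1 < min N 0" by linarith
    from concave_on_differentiable_somewhere[OF conc this] obtain x where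
      "x < min N 0" "K differentiable (at x)" by auto
    with N[of x] show False by simp
  qed
  show "((\<lambda>t. ereal (deriv K t)) \<longlongrightarrow> (SUP s\<in>?A. ereal (deriv K s)))
      (inf at_bot (principal {t. K differentiable (at t)}))"
  proof (rule order_tendstoI)
    fix a assume "a < (SUP s\<in>?A. ereal (deriv K s))"
    then obtain s where s: "s \<in> ?A" "a < ereal (deriv K s)" by (auto simp: less_SUP_iff)
    have "a < ereal (deriv K t)" if "t \<le> s" "K differentiable (at t)" for t
      using anti[of t s] s that by (auto intro: less_le_trans)
    then show "eventually (\<lambda>t. a < ereal (deriv K t)) (inf at_bot (principal {t. K differentiable (at t)}))"
      by (auto simp: eventually_inf_principal eventually_at_bot_linorder)
  next
    fix a assume a: "(SUP s\<in>?A. ereal (deriv K s)) < a"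
    have "ereal (deriv K t) < a" if "t \<le> - 1" "K differentiable (at t)" for t
      using a that by (intro le_less_trans[OF SUP_upper a]) auto
    then show "eventually (\<lambda>t. ereal (deriv K t) < a) (inf at_bot (principal {t. K differentiable (at t)}))"
      by (auto simp: eventually_inf_principal eventually_at_bot_linorder)
  qed
qed

lemma deriv_limit_at_top:
  fixes K :: "real \<Rightarrow> real"
  assumes K: "concave_on {0<..} K"
  shows "deriv_limit at_top K = (INF s\<in>{s. 0 < s \<and> K differentiable (at s)}. ereal (deriv K s))"
    (is "_ = Inf (_ ` ?A)")
  unfolding deriv_limit_def
proof (rule tendsto_Lim)
  have anti: "deriv K t \<le> deriv K s" if "s \<in> ?A" "t \<in> ?A" "s \<le> t" for s t
    by (rule concave_on_deriv_antimono[OF K]) (use that in auto)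
  show "\<not> trivial_limit (inf at_top (principal {t. K differentiable (at t)}))"
  proof
    assume "trivial_limit (inf at_top (principal {t. K differentiable (at t)}))"
    then obtain N where N: "\<And>t. N \<le> t \<Longrightarrow> \<not> K differentiable (at t)"
      by (auto simp: trivial_limit_def eventually_inf_principal eventually_at_top_linorder)
    have "concave_on {max N 0<..<max N 0 + 1} K"
      using K by (rule concave_on_subset) auto
    from concave_on_differentiable_somewhere[OF this] obtain x where
      "max N 0 < x" "K differentiable (at x)" by auto
    with N[of x] show False by simp
  qed
  show "((\<lambda>t. ereal (deriv K t)) \<longlongrightarrow> (INF s\<in>?A. ereal (deriv K s)))
      (inf at_top (principal {t. K differentiable (at t)}))"
  proof (rule order_tendstoI)
    fix a assume "(INF s\<in>?A. ereal (deriv K s)) < a"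
    then obtain s where s: "s \<in> ?A" "ereal (deriv K s) < a" by (auto simp: INF_less_iff)
    have "ereal (deriv K t) < a" if "s \<le> t" "K differentiable (at t)" for t
      using anti[of s t] s that by (intro le_less_trans[OF _ s(2)]) auto
    then show "eventually (\<lambda>t. ereal (deriv K t) < a) (inf at_top (principal {t. K differentiable (at t)}))"
      by (auto simp: eventually_inf_principal eventually_at_top_linorder)
  next
    fix a assume a: "a < (INF s\<in>?A. ereal (deriv K s))"
    have "a < ereal (deriv K t)" if "1 \<le> t" "K differentiable (at t)" for t
      using a that by (intro less_le_trans[OF a INF_lower]) auto
    then show "eventually (\<lambda>t. a < ereal (deriv K t)) (inf at_top (principal {t. K differentiable (at t)}))"
      by (auto simp: eventually_inf_principal eventually_at_top_linorder)
  qed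
qed

lemma singular_kernel_tendsto:
  assumes "kernel_function K" "singular_kernel K"
  shows "((\<lambda>t. ereal (K t)) \<longlongrightarrow> - \<infinity>) (at 0)"
proof -
  obtain c where c: "((\<lambda>t. ereal (K t)) \<longlongrightarrow> c) (at 0)"
    using assms(1) by (auto simp: kernel_function_def filterlim_at_split)
  then have "Lim (at 0) (\<lambda>t. ereal (K t)) = c"
    by (intro tendsto_Lim) auto
  with assms(2) c show ?thesis
    by (simp add: singular_kernel_def kernel_ext_def)
qed

text \<open>
  Generalized monotonicity provides a slope separating the derivatives on the two half-lines;
  subtracting the corresponding linear function makes the kernel monotone on each of them.
\<close>

lemma ex_monotone_normalization:
  assumes kernel: "kernel_function K" and sing: "singular_kernel K"
    and strict: "strictly_concave_kernel K" and mono: "generalized_monotone K"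
  obtains c where "monotone_kernel (\<lambda>t. K t - c * t)"
proof -
  have conc: "concave_on {..<0} K" "concave_on {0<..} K"
    using kernel by (auto simp: kernel_function_def)
  have sconc: "strictly_concave_on {..<0} K" "strictly_concave_on {0<..} K"
    using strict by (auto simp: strictly_concave_kernel_def)
  have differentiable: "\<exists>x\<in>{a<..<b}. K differentiable (at x)" if "a < b" "b \<le> 0 \<or> 0 \<le> a" for a b
    using that conc by (intro concave_on_differentiable_somewhere)
      (auto elim: concave_on_subset)
  let ?L = "deriv_limit at_bot K"
  have left: "ereal (deriv K s) \<le> ?L" if "s < 0" "K differentiable (at s)" for s
    unfolding deriv_limit_at_bot[OF conc(1)] using that by (intro SUP_upper) auto
  have right: "?L \<le> ereal (deriv K t)" if "0 < t" "K differentiable (at t)" for t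
  proof -
    have "?L \<le> deriv_limit at_top K" using mono by (simp add: generalized_monotone_def)
    also have "\<dots> \<le> ereal (deriv K t)"
      unfolding deriv_limit_at_top[OF conc(2)] using that by (intro INF_lower) auto
    finally show ?thesis .
  qed
  \<comment> \<open>One derivative on each side bounds the limit from below and from above, so it is
    real.\<close>
  obtain s0 t0 where "s0 < 0" "K differentiable (at s0)" "0 < t0" "K differentiable (at t0)"
    using differentiable[of "- 1" 0] differentiable[of 0 1] by auto
  with left right obtain c where c: "?L = ereal c"
    by (cases ?L) fastforce+
  have left: "deriv K s \<le> c" if "s < 0" "K differentiable (at s)" for s
    using left[OF that] c by simp
  have right: "c \<le> deriv K t" if "0 < t" "K differentiable (at t)" for t
    using right[OF that] c by simp
  have "monotone_kernel (\<lambda>t. K t - c * t)"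
  proof
    have "concave_on A (\<lambda>t. K t - c * t)" if "concave_on A K" for A
      using that unfolding concave_on_iff
    proof (elim conjE, intro conjI ballI allI impI)
      fix x y u v :: real
      assume *: "\<forall>x\<in>A. \<forall>y\<in>A. \<forall>u\<ge>0. \<forall>v\<ge>0. u + v = 1 \<longrightarrow> u * K x + v * K y \<le> K (u *\<^sub>R x + v *\<^sub>R y)"
        and uv: "x \<in> A" "y \<in> A" "0 \<le> u" "0 \<le> v" "u + v = 1"
      have "u * K x + v * K y \<le> K (u *\<^sub>R x + v *\<^sub>R y)" using * uv by blast
      then show "u * (K x - c * x) + v * (K y - c * y) \<le> K (u *\<^sub>R x + v *\<^sub>R y) - c * (u *\<^sub>R x + v *\<^sub>R y)"
        by (simp add: algebra_simps)
    qed
    then show "concave_on {..<0} (\<lambda>t. K t - c * t)" "concave_on {0<..} (\<lambda>t. K t - c * t)"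
      using conc by auto
  next
    fix s t :: real assume st: "s < t" "t < 0"
    \<comment> \<open>The tangent at \<open>w\<close> gives the chord over \<open>[w, s]\<close> a
      slope at most \<open>c\<close>; by strict concavity the next chord, over
      \<open>[s, t]\<close>, has slope strictly below \<open>c\<close>.\<close>
    obtain w where w: "w < s" "K differentiable (at w)"
      using differentiable[of "s - 1" s] st by auto
    have "K s - K w \<le> deriv K w * (s - w)"
      by (rule concave_on_below_tangent[OF conc(1)]) (use w st in auto)
    also have "\<dots> \<le> c * (s - w)" using left[of w] w st by (intro mult_right_mono) auto
    finally have "(K s - K w) * (t - s) \<le> c * (s - w) * (t - s)"
      using st by (intro mult_right_mono) auto
    moreover have "(K t - K s) * (s - w) < (K s - K w) * (t - s)"
      by (rule strictly_concave_on_slopes[OF sconc(1)]) (use w st in auto)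
    ultimately have "(K t - K s) * (s - w) < (c * (t - s)) * (s - w)" by (simp add: mult_ac)
    then have "K t - K s < c * (t - s)" using w by simp
    then show "K t - c * t < K s - c * s" by (simp add: algebra_simps)
  next
    fix s t :: real assume st: "0 < s" "s < t"
    obtain w where w: "t < w" "K differentiable (at w)"
      using differentiable[of t "t + 1"] st by auto
    have "K t - K w \<le> deriv K w * (t - w)"
      by (rule concave_on_below_tangent[OF conc(2)]) (use w st in auto)
    also have "\<dots> \<le> c * (t - w)" using right[of w] w st by (intro mult_right_mono_neg) auto
    finally have "c * (w - t) \<le> K w - K t" by (simp add: algebra_simps)
    then have "c * (w - t) * (t - s) \<le> (K w - K t) * (t - s)"
      using st by (intro mult_right_mono) auto
    moreover have "(K w - K t) * (t - s) < (K t - K s) * (w - t)"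
      by (rule strictly_concave_on_slopes[OF sconc(2)]) (use w st in auto)
    ultimately have "(c * (t - s)) * (w - t) < (K t - K s) * (w - t)" by (simp add: mult_ac)
    then have "c * (t - s) < K t - K s" using w by simp
    then show "K s - c * s < K t - c * t" by (simp add: algebra_simps)
  next
    fix B
    \<comment> \<open>The margin \<open>\<bar>c\<bar>\<close> absorbs the linear term on
      \<open>\<bar>t\<bar> < 1\<close>.\<close>
    have "eventually (\<lambda>t. ereal (K t) < ereal (B - \<bar>c\<bar>)) (at 0)"
      using singular_kernel_tendsto[OF kernel sing] by (simp add: tendsto_MInfty)
    then obtain d where d: "0 < d" "\<And>t. t \<noteq> 0 \<Longrightarrow> \<bar>t\<bar> < d \<Longrightarrow> K t < B - \<bar>c\<bar>"
      by (auto simp: eventually_at dist_real_def)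
    have "K t - c * t \<le> B" if "t \<noteq> 0" "\<bar>t\<bar> < min d 1" for t
    proof -
      have "\<bar>c * t\<bar> \<le> \<bar>c\<bar> * 1" using that unfolding abs_mult by (intro mult_left_mono) auto
      with d(2)[of t] that show ?thesis by (simp add: abs_le_iff)
    qed
    then show "\<exists>\<epsilon>>0. \<forall>t. t \<noteq> 0 \<and> \<bar>t\<bar> < \<epsilon> \<longrightarrow> K t - c * t \<le> B"
      using d(1) by (intro exI[of _ "min d 1"]) auto
  qed
  then show ?thesis by (rule that)
qed

section \<open>Reduction to monotone kernels\<close>

text \<open>
  The linear functions subtracted from the kernels are added to the field \<open>J0\<close>. This shifts all the
  interval suprema by the same amount, which does not affect their differences.
\<close>

locale normalized_system = translates_system K J S
  for K :: "'n::{finite,linorder} \<Rightarrow> real \<Rightarrow> real" and J S +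
  fixes K0 :: "'n::{finite,linorder} \<Rightarrow> real \<Rightarrow> real" and J0 :: "real \<Rightarrow> ereal" and c :: "'n \<Rightarrow> real"
  assumes K_eq: "K l t = K0 l t - c l * t"
    and J_eq: "J t = real_of_ereal (J0 t) + (\<Sum>l\<in>UNIV. c l) * t"
    and S_eq: "S = {t. J0 t \<noteq> - \<infinity>}"
    and J0_not_PInf: "J0 t \<noteq> \<infinity>"
    and singular: "singular_kernel (K0 l)"
begin

text \<open>What remains of the subtracted functions \<open>c l * (t - y $ l)\<close> once their
  part in \<open>t\<close> has cancelled against the field.\<close>

definition shift :: "real ^ 'n::{finite,linorder} \<Rightarrow> real" where
  "shift y = (\<Sum>l\<in>UNIV. c l * y $ l)"

lemma sum_translates_eq:
  assumes "t \<in> S" "\<And>l. t \<noteq> y $ l"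
  shows "sum_translates J0 K0 y t = ereal (F y t - shift y)"
proof -
  have "J0 t = ereal (real_of_ereal (J0 t))"
    using assms(1) J0_not_PInf[of t] by (cases "J0 t") (auto simp: S_eq)
  moreover have "kernel_ext (K0 l) (t - y $ l) = ereal (K0 l (t - y $ l))" for l
    using assms(2)[of l] by (simp add: kernel_ext_def)
  ultimately have "sum_translates J0 K0 y t =
      ereal (real_of_ereal (J0 t) + (\<Sum>l\<in>UNIV. K0 l (t - y $ l)))"
    by (metis (no_types, lifting) plus_ereal.simps(1) sum.cong sum_ereal sum_translates_def)
  also have "real_of_ereal (J0 t) + (\<Sum>l\<in>UNIV. K0 l (t - y $ l)) = F y t - shift y"
    by (simp add: F_def K_eq J_eq shift_def sum_subtractf sum_distrib_right right_diff_distrib)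
  finally show ?thesis .
qed

text \<open>In \<open>ereal\<close> a summand plus infinity would absorb minus infinity, so it has
  to be excluded from every partial sum.\<close>

lemma sum_translates_eq_MInf:
  assumes "t \<notin> S \<or> t = y $ l"
  shows "sum_translates J0 K0 y t = - \<infinity>"
proof -
  have fin: "kernel_ext (K0 k) s \<noteq> \<infinity>" for k s
    using singular[of k] by (auto simp: kernel_ext_def singular_kernel_def)
  then have sum: "(\<Sum>k\<in>A. kernel_ext (K0 k) (t - y $ k)) \<noteq> \<infinity>" for A
    by (simp add: sum_Pinfty)
  show ?thesis
  proof (cases "t \<in> S")
    case False
    with sum[of UNIV] show ?thesis
      by (auto simp: sum_translates_def S_eq)
  next
    case True
    with assms have "kernel_ext (K0 l) (t - y $ l) = - \<infinity>"
      using singular[of l] by (simp add: singular_kernel_def)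
    with sum[of "UNIV - {l}"] have "(\<Sum>k\<in>UNIV. kernel_ext (K0 k) (t - y $ k)) = - \<infinity>"
      by (subst sum.remove[of _ l]) auto
    with J0_not_PInf[of t] show ?thesis by (simp add: sum_translates_def)
  qed
qed

text \<open>Monotone coordinates let the endpoint conditions speak for all nodes. This gives the
  closed counterpart of \<open>finite_points\<close>.\<close>

lemma mem_node_interval_iff:
  fixes y :: "real ^ 'n::{finite,linorder}"
  assumes y: "y \<in> closed_simplex" and j: "j \<le> CARD('n)"
  shows "t \<in> node_interval y j \<longleftrightarrow> (\<forall>l. if card {..l} \<le> j then y $ l \<le> t else t \<le> y $ l)"
proof -
  have mono: "y $ i \<le> y $ k" if "i \<le> k" for i k
    using y that by (simp add: closed_simplex_def)
  have left: "y $ nth_index j \<le> t \<longleftrightarrow> (\<forall>l. card {..l} \<le> j \<longrightarrow> y $ l \<le> t)" if "1 \<le> j" "j \<le> CARD('n)" for j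
  proof -
    have rank: "card {..l} \<le> j \<longleftrightarrow> l \<le> nth_index j" for l :: 'n
      using card_atMost_le_iff[of l "nth_index j"] card_atMost_nth_index[OF that] by simp
    show ?thesis unfolding rank by (auto intro: order_trans[OF mono])
  qed
  have right: "t \<le> y $ nth_index j \<longleftrightarrow> (\<forall>l. j \<le> card {..l} \<longrightarrow> t \<le> y $ l)" if "1 \<le> j" "j \<le> CARD('n)" for j
  proof -
    have rank: "j \<le> card {..l} \<longleftrightarrow> nth_index j \<le> l" for l :: 'n
      using card_atMost_le_iff[of "nth_index j" l] card_atMost_nth_index[OF that] by simp
    show ?thesis unfolding rank by (auto intro: order_trans[OF _ mono])
  qed
  have zero: "\<not> card {..l} \<le> 0" and one: "1 \<le> card {..l}" and top: "card {..l} \<le> CARD('n)" for l :: 'n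
    using card_atMost_bounds[of l] by linarith+
  consider "j = 0" | "j = CARD('n)" "j \<noteq> 0" | "1 \<le> j" "j < CARD('n)" using j by linarith
  then show ?thesis
  proof cases
    case 1
    have "t \<in> node_interval y j \<longleftrightarrow> t \<le> y $ nth_index 1" using 1 by (simp add: node_interval_def)
    also have "\<dots> \<longleftrightarrow> (\<forall>l. t \<le> y $ l)" using right[of 1] one by simp
    finally show ?thesis using 1 zero by simp
  next
    case 2
    have "t \<in> node_interval y j \<longleftrightarrow> y $ nth_index (CARD('n)) \<le> t" using 2 by (simp add: node_interval_def)
    also have "\<dots> \<longleftrightarrow> (\<forall>l. y $ l \<le> t)" using left[of "CARD('n)"] top by simp
    finally show ?thesis using 2 top by simp
  next
    case 3
    have "t \<in> node_interval y j \<longleftrightarrow> y $ nth_index j \<le> t \<and> t \<le> y $ nth_index (j + 1)"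
      using 3 by (simp add: node_interval_def)
    also have "\<dots> \<longleftrightarrow> (\<forall>l. card {..l} \<le> j \<longrightarrow> y $ l \<le> t) \<and> (\<forall>l. j + 1 \<le> card {..l} \<longrightarrow> t \<le> y $ l)"
      using left[of j] right[of "j + 1"] 3 by simp
    finally show ?thesis by (auto simp: not_le Suc_le_eq)
  qed
qed

text \<open>Points of the closed interval outside \<open>finite_points\<close> are nodes or lie
  outside \<open>S\<close>, and contribute minus infinity. The empty case is separate because there
  the real supremum \<open>m\<close> carries no meaning.\<close>

lemma interval_sup_eq:
  assumes y: "y \<in> closed_simplex" and j: "j \<le> CARD('n)"
  shows "interval_sup J0 K0 j y = (if finite_points y j = {} then - \<infinity> else ereal (m j y - shift y))"
proof -
  let ?s = "interval_sup J0 K0 j y"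
  have outside: "sum_translates J0 K0 y t = - \<infinity>" if "t \<in> node_interval y j" "t \<notin> finite_points y j" for t
  proof -
    have "t \<notin> S \<or> (\<exists>l. t = y $ l)"
    proof (rule ccontr)
      assume *: "\<not> ?thesis"
      have side: "if card {..l} \<le> j then y $ l \<le> t else t \<le> y $ l" for l
        using that(1) mem_node_interval_iff[OF y j] by blast
      have "t \<in> finite_points y j"
      proof (rule finite_pointsI)
        show "y $ l < t" if "card {..l} \<le> j" for l
          using side[of l] that * by (auto simp: order.order_iff_strict)
        show "t < y $ l" if "j < card {..l}" for l
          using side[of l] that * by (auto simp: order.order_iff_strict)
      qed (use * in blast)
      with that(2) show False by contradiction
    qed
    then show ?thesis using sum_translates_eq_MInf by metis
  qed
  have inside: "t \<in> node_interval y j" "sum_translates J0 K0 y t = ereal (F y t - shift y)"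
    if t: "t \<in> finite_points y j" for t
  proof -
    show "sum_translates J0 K0 y t = ereal (F y t - shift y)"
      by (rule sum_translates_eq) (use finite_pointsD[OF t] in auto)
    show "t \<in> node_interval y j"
      unfolding mem_node_interval_iff[OF y j] using finite_pointsD(2,3)[OF t]
      by (simp add: not_le order_less_imp_le)
  qed
  have le: "?s \<le> ereal (m j y - shift y)"
    unfolding interval_sup_def
  proof (rule SUP_least)
    fix t assume "t \<in> node_interval y j"
    then show "sum_translates J0 K0 y t \<le> ereal (m j y - shift y)"
      using outside[of t] inside(2)[of t] F_le_m[of t y j] by (cases "t \<in> finite_points y j") auto
  qed
  have ge: "ereal (F y t - shift y) \<le> ?s" if t: "t \<in> finite_points y j" for t
    unfolding interval_sup_def inside(2)[OF t, symmetric] by (intro SUP_upper inside(1)[OF t])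
  show ?thesis
  proof (cases "finite_points y j = {}")
    case True
    then have "?s \<le> - \<infinity>"
      unfolding interval_sup_def using outside by (intro SUP_least) auto
    with True show ?thesis by simp
  next
    case False
    then obtain t0 where t0: "t0 \<in> finite_points y j" by blast
    obtain r where r: "?s = ereal r"
      using le ge[OF t0] by (cases ?s) auto
    have "m j y \<le> r + shift y"
      using ge r by (intro m_leI[OF False]) (simp add: diff_le_eq)
    with le r False show ?thesis by simp
  qed
qed

lemma regularity_set_eq: "regularity_set J0 K0 = R"
proof -
  have "y \<in> closed_simplex" if "y \<in> R" for y
    using R_imp_mono[OF that] by (simp add: closed_simplex_def)
  then show ?thesis
    by (auto simp: regularity_set_def R_def interval_sup_eq split: if_splits)
qed

lemma difference_function_eq:
  assumes "y \<in> R"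
  shows "difference_function J0 K0 y = D y"
proof -
  have y: "y \<in> closed_simplex" using R_imp_mono[OF assms] by (simp add: closed_simplex_def)
  have "interval_sup J0 K0 j y = ereal (m j y - shift y)" if "j \<le> CARD('n)" for j
    using interval_sup_eq[OF y that] assms that by (simp add: R_def)
  moreover have "card {..k} \<le> CARD('n)" "card {..<k} \<le> CARD('n)" for k :: 'n
    by (auto intro: card_mono)
  ultimately show ?thesis by (simp add: difference_function_def D_def)
qed

lemma difference_function_homeomorphism:
  "\<exists>g. homeomorphism (regularity_set J0 K0) UNIV (difference_function J0 K0) g"
proof -
  obtain g where "homeomorphism R UNIV D g" using D_homeomorphism by blast
  then have "homeomorphism R UNIV (difference_function J0 K0) g"
    by (rule homeomorphism_cong) (auto simp: difference_function_eq)
  then show ?thesis by (auto simp: regularity_set_eq)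
qed

lemma difference_function_locally_bi_Lipschitz:
  "locally_bi_Lipschitz_on (regularity_set J0 K0) (difference_function J0 K0)"
  unfolding locally_bi_Lipschitz_on_def regularity_set_eq
proof
  fix z assume "z \<in> R"
  from D_locally_bi_Lipschitz_on[unfolded locally_bi_Lipschitz_on_def, THEN bspec, OF this]
  obtain U c C where U: "openin (top_of_set R) U" "z \<in> U" "0 < c" "c \<le> C"
    and lip: "\<forall>x\<in>U. \<forall>y\<in>U. c * norm (x - y) \<le> norm (D x - D y) \<and> norm (D x - D y) \<le> C * norm (x - y)"
    by (elim exE conjE) (rule that; assumption)
  have "difference_function J0 K0 x = D x" if "x \<in> U" for x
    using difference_function_eq openin_imp_subset[OF U(1)] that by blast
  with U lip show "\<exists>U c C. openin (top_of_set R) U \<and> z \<in> U \<and> 0 < c \<and> c \<le> C \<and>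
      (\<forall>x\<in>U. \<forall>y\<in>U. c * norm (x - y) \<le> norm (difference_function J0 K0 x - difference_function J0 K0 y) \<and>
        norm (difference_function J0 K0 x - difference_function J0 K0 y) \<le> C * norm (x - y))"
    by - (rule exI[of _ U], rule exI[of _ c], rule exI[of _ C], simp)
qed

end

text \<open>The added linear term may destroy the global upper bound of the field, which is why
  \<open>translates_system\<close> asks for bounds on bounded sets only. At infinity it cancels
  against the kernels, so admissibility carries over.\<close>

lemma ex_normalized_system:
  fixes K :: "'n::{finite,linorder} \<Rightarrow> real \<Rightarrow> real" and J :: "real \<Rightarrow> ereal"
  assumes kernel: "\<And>j. kernel_function (K j)" and sing: "\<And>j. singular_kernel (K j)"
    and strict: "\<And>j. strictly_concave_kernel (K j)" and mono: "\<And>j. generalized_monotone (K j)"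
    and field: "field_function (CARD('n)) J" and adm: "admissible J K"
  obtains K' J' S c where "normalized_system K' J' S K J c"
proof -
  have "\<exists>c. monotone_kernel (\<lambda>t. K l t - c * t)" for l
    using ex_monotone_normalization[OF kernel sing strict mono] by blast
  then obtain c where c: "\<And>l. monotone_kernel (\<lambda>t. K l t - c l * t)" by metis
  define K' where "K' l t = K l t - c l * t" for l t
  define J' where "J' t = real_of_ereal (J t) + (\<Sum>l\<in>UNIV. c l) * t" for t
  define S where "S = {t. J t \<noteq> - \<infinity>}"
  obtain M where M: "\<And>t. J t \<le> ereal M" using field by (auto simp: field_function_def)
  have notPInf: "J t \<noteq> \<infinity>" for t using M[of t] by auto
  have "normalized_system K' J' S K J c"
  proof (intro normalized_system.intro translates_system.intro normalized_system_axioms.intro)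
    show "monotone_kernel (K' l)" for l using c[of l] by (simp add: K'_def[abs_def])
    show "\<exists>M. \<forall>t\<in>S. \<bar>t\<bar> \<le> a \<longrightarrow> J' t \<le> M" for a
    proof (rule exI[of _ "M + \<bar>\<Sum>l\<in>UNIV. c l\<bar> * a"], intro ballI impI)
      fix t assume t: "t \<in> S" "\<bar>t\<bar> \<le> a"
      have "real_of_ereal (J t) \<le> M" using M[of t] t(1) by (cases "J t") (auto simp: S_def)
      moreover have "(\<Sum>l\<in>UNIV. c l) * t \<le> \<bar>\<Sum>l\<in>UNIV. c l\<bar> * a"
        using mult_left_mono[OF t(2), of "\<bar>\<Sum>l\<in>UNIV. c l\<bar>"] abs_ge_self[of "(\<Sum>l\<in>UNIV. c l) * t"]
        unfolding abs_mult by linarith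
      ultimately show "J' t \<le> M + \<bar>\<Sum>l\<in>UNIV. c l\<bar> * a" by (simp add: J'_def)
    qed
    show "\<exists>T. \<forall>t\<in>S. T \<le> \<bar>t\<bar> \<longrightarrow> J' t + (\<Sum>l\<in>UNIV. K' l t) \<le> B" for B
    proof -
      have "eventually (\<lambda>t. J t + (\<Sum>j\<in>UNIV. kernel_ext (K j) t) < ereal B) at_infinity"
        using adm by (simp add: admissible_def tendsto_MInfty)
      then obtain b where b: "\<And>t. b \<le> \<bar>t\<bar> \<Longrightarrow> J t + (\<Sum>j\<in>UNIV. kernel_ext (K j) t) < ereal B"
        by (auto simp: eventually_at_infinity)
      \<comment> \<open>The 1 in the maximum keeps \<open>t\<close> away from 0, where
        \<open>kernel_ext\<close> is a limit rather than a value of \<open>K\<close>.\<close>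
      have "J' t + (\<Sum>l\<in>UNIV. K' l t) \<le> B" if t: "t \<in> S" "max b 1 \<le> \<bar>t\<bar>" for t
      proof -
        have "kernel_ext (K l) t = ereal (K l t)" for l
          using t(2) by (auto simp: kernel_ext_def)
        moreover obtain r where "J t = ereal r"
          using t(1) notPInf[of t] by (cases "J t") (auto simp: S_def)
        ultimately show ?thesis
          using b[of t] t(2) by (simp add: J'_def K'_def sum_subtractf sum_distrib_right)
      qed
      then show ?thesis by blast
    qed
    show "infinite S \<or> CARD('n) < card S"
      using field by (simp add: field_function_def S_def)
  qed (use sing notPInf in \<open>auto simp: K'_def J'_def S_def\<close>)
  then show ?thesis by (rule that)
qed

theorem theorem1p1:
  fixes K :: "'n::{finite,linorder} \<Rightarrow> real \<Rightarrow> real"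
    and J :: "real \<Rightarrow> ereal"
  assumes "\<And>j. kernel_function (K j)"
    and "\<And>j. singular_kernel (K j)"
    and "\<And>j. strictly_concave_kernel (K j)"
    and "\<And>j. generalized_monotone (K j)"
    and "field_function (CARD('n)) J"
    and "admissible J K"
  shows "(\<exists>g. homeomorphism (regularity_set J K) UNIV (difference_function J K) g) \<and>
         locally_bi_Lipschitz_on (regularity_set J K) (difference_function J K)"
proof -
  obtain K' J' S c where "normalized_system K' J' S K J c"
    using ex_normalized_system[OF assms] by blast
  then show ?thesis
    using normalized_system.difference_function_homeomorphism
      normalized_system.difference_function_locally_bi_Lipschitz by blast
qed

end
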